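(* Let $\mathcal T\subseteq\mathcal H$ be a finite-dimensional subspace, let $K>0$, and let $\Omega=\{\omega_1<\dots<\omega_N\}$ be $(K,\delta)$-dense, where $$\delta<\sqrt{1-E(\mathcal T,K-1/2)^2}.$$ Let $\mathcal S$ be the weighted sampling operator $$\mathcal S f(x)=\sum_{n=1}^N \mu_n\hat f(\omega_n)e^{2\pi i\omega_n x}\mathbb 1_{[0,1]}(x),\qquad \mu_n=\tfrac12(\omega_{n+1}-\omega_{n-1}),$$ with the convention $\omega_0=\omega_N-2K$, $\omega_{N+1}=\omega_1+2K$. Then $\mathcal S$ is an admissible sampling operator for the pair $(\Omega,\mathcal T)$, and its reconstruction constant satisfies $$C(\Omega,\mathcal T)\le\frac{1+\delta}{\sqrt{1-E(\mathcal T,K-1/2)^2}-\delta}.$$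
   Context: For $f\in L^2(\mathbb R)$, $\hat f(\omega)=\int_{\mathbb R}f(x)e^{-2\pi i\omega x}\,dx$; $\langle\cdot,\cdot\rangle$ and $\|\cdot\|$ are the $L^2(\mathbb R)$ inner product and norm, and for a measurable $J\subseteq\mathbb R$, $\|g\|_J^2=\int_J|g|^2$. Let $\mathcal H=\{f\in L^2(\mathbb R):\operatorname{supp}f\subseteq[0,1]\}$. $(K,\delta)$-density: for $K>0$ and $0<\delta<1$, a finite set $\Omega=\{\omega_1<\dots<\omega_N\}\subset\mathbb R$ is $(K,\delta)$-dense if $\Omega\subseteq[-K,K]$ and $\max_{n=0,\dots,N}(\omega_{n+1}-\omega_n)\le\delta$, where $\omega_0=\omega_N-2K$, $\omega_{N+1}=\omega_1+2K$. $z$-residual: for $\mathcal T\subseteq\mathcal H$ and $z\ge0$, $E(\mathcal T,z)=\sup\{\|\hat f\|_{\mathbb R\setminus(-z,z)}: f\in\mathcal T,\ \|f\|=1\}$. Admissibility: a bounded linear operator $\mathcal S:\mathcal H\to\mathcal H$ is admissible for $(\Omega,\mathcal T)$ if (i) for each $f\in\mathcal H$, $\mathcal Sf$ depends only on the data $\{\hat f(\omega):\omega\in\Omega\}$; (ii) $\mathcal S$ is self-adjoint and $|\langle\mathcal Sf,g\rangle|\le\sqrt{\langle\mathcal Sf,f\rangle\langle\mathcal Sg,g\rangle}$ for all $f,g\in\mathcal H$; (iii) there is $C_1>0$ with $\langle\mathcal Sf,f\rangle\ge C_1\|f\|^2$ for all $f\in\mathcal T$. Constants: $C_1(\Omega,\mathcal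 T)$ is the largest constant with $\langle\mathcal Sf,f\rangle\ge C_1\|f\|^2$ for all $f\in\mathcal T$; $C_2(\Omega)$ is the smallest constant with $\langle\mathcal Sf,f\rangle\le C_2\|f\|^2$ for all $f\in\mathcal H$; the reconstruction constant is $C(\Omega,\mathcal T)=\sqrt{C_2(\Omega)/C_1(\Omega,\mathcal T)}$. *)

theory Defs
  imports "HOL-Analysis.Analysis"
begin

type_synonym fn = "real \<Rightarrow> complex"

text \<open>The space H: square-integrable functions vanishing outside [0,1]
  (functions are representatives of L2 classes).\<close>
definition HH :: "fn set" where
  "HH = {f. f \<in> borel_measurable lborel \<and> integrable lborel (\<lambda>x. (cmod (f x))^2)
            \<and> (\<forall>x. x \<notin> {0..1} \<longrightarrow> f x = 0)}"

definition inner_L2 :: "fn \<Rightarrow> fn \<Rightarrow> complex" where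
  "inner_L2 f g = (LINT x|lborel. f x * cnj (g x))"

definition norm_L2 :: "fn \<Rightarrow> real" where
  "norm_L2 f = sqrt (LINT x|lborel. (cmod (f x))^2)"

definition norm_on :: "real set \<Rightarrow> fn \<Rightarrow> real" where
  "norm_on J g = sqrt (set_lebesgue_integral lborel J (\<lambda>x. (cmod (g x))^2))"

definition fourier :: "fn \<Rightarrow> real \<Rightarrow> complex" where
  "fourier f w = (LINT x|lborel. f x * cis (-2 * pi * w * x))"

definition fin_dim_subspace :: "fn set \<Rightarrow> bool" where
  "fin_dim_subspace T \<longleftrightarrow> T \<subseteq> HH \<and> (\<lambda>x. 0) \<in> T
     \<and> (\<forall>f\<in>T. \<forall>g\<in>T. (\<lambda>x. f x + g x) \<in> T)
     \<and> (\<forall>f\<in>T. \<forall>c::complex. (\<lambda>x. c * f x) \<in> T)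
     \<and> (\<exists>B. finite B \<and> B \<subseteq> T \<and> T = {(\<lambda>x. \<Sum>b\<in>B. c b * b x) | c. True})"

text \<open>z-residual E(T,z); convention: supremum over the empty set is 0.\<close>
definition resid :: "fn set \<Rightarrow> real \<Rightarrow> real" where
  "resid T z = Sup (insert 0 {norm_on (UNIV - {-z<..<z}) (fourier f) | f. f \<in> T \<and> norm_L2 f = 1})"

definition wext :: "real \<Rightarrow> nat \<Rightarrow> (nat \<Rightarrow> real) \<Rightarrow> nat \<Rightarrow> real" where
  "wext K N w n = (if n = 0 then w N - 2 * K else if n = N + 1 then w 1 + 2 * K else w n)"

definition KD_dense :: "real \<Rightarrow> real \<Rightarrow> nat \<Rightarrow> (nat \<Rightarrow> real) \<Rightarrow> bool" where
  "KD_dense K \<delta> N w \<longleftrightarrow> K > 0 \<and> 0 < \<delta> \<and> \<delta> < 1 \<and> N \<ge> 1 \<and> strict_mono_on {1..N} w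
     \<and> w ` {1..N} \<subseteq> {-K..K}
     \<and> (\<forall>n\<in>{0..N}. wext K N w (n + 1) - wext K N w n \<le> \<delta>)"

definition weight :: "real \<Rightarrow> nat \<Rightarrow> (nat \<Rightarrow> real) \<Rightarrow> nat \<Rightarrow> real" where
  "weight K N w n = (wext K N w (n + 1) - wext K N w (n - 1)) / 2"

definition samp_op :: "real \<Rightarrow> nat \<Rightarrow> (nat \<Rightarrow> real) \<Rightarrow> fn \<Rightarrow> fn" where
  "samp_op K N w f x =
     (\<Sum>n=1..N. complex_of_real (weight K N w n) * fourier f (w n) * cis (2 * pi * w n * x))
       * indicator {0..1} x"

definition bounded_linear_op :: "(fn \<Rightarrow> fn) \<Rightarrow> bool" where
  "bounded_linear_op S \<longleftrightarrow> (\<forall>f\<in>HH. S f \<in> HH)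
     \<and> (\<forall>f\<in>HH. \<forall>g\<in>HH. S (\<lambda>x. f x + g x) = (\<lambda>x. S f x + S g x))
     \<and> (\<forall>f\<in>HH. \<forall>c::complex. S (\<lambda>x. c * f x) = (\<lambda>x. c * S f x))
     \<and> (\<exists>B. \<forall>f\<in>HH. norm_L2 (S f) \<le> B * norm_L2 f)"

definition admissible :: "(fn \<Rightarrow> fn) \<Rightarrow> real set \<Rightarrow> fn set \<Rightarrow> bool" where
  "admissible S \<Omega> T \<longleftrightarrow> bounded_linear_op S
     \<and> (\<forall>f\<in>HH. \<forall>g\<in>HH. (\<forall>w\<in>\<Omega>. fourier f w = fourier g w) \<longrightarrow> S f = S g)
     \<and> (\<forall>f\<in>HH. \<forall>g\<in>HH. inner_L2 (S f) g = inner_L2 f (S g))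
     \<and> (\<forall>f\<in>HH. \<forall>g\<in>HH. cmod (inner_L2 (S f) g)
            \<le> sqrt (Re (inner_L2 (S f) f) * Re (inner_L2 (S g) g)))
     \<and> (\<exists>C1>0. \<forall>f\<in>T. Re (inner_L2 (S f) f) \<ge> C1 * (norm_L2 f)^2)"

text \<open>C1: largest lower constant on T (+infinity if T = {0}); C2: smallest upper constant on H.\<close>
definition lower_const :: "(fn \<Rightarrow> fn) \<Rightarrow> fn set \<Rightarrow> ereal" where
  "lower_const S T = Sup {ereal c | c. \<forall>f\<in>T. Re (inner_L2 (S f) f) \<ge> c * (norm_L2 f)^2}"

definition upper_const :: "(fn \<Rightarrow> fn) \<Rightarrow> ereal" where
  "upper_const S = Inf {ereal c | c. \<forall>f\<in>HH. Re (inner_L2 (S f) f) \<le> c * (norm_L2 f)^2}"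

definition recon_const :: "(fn \<Rightarrow> fn) \<Rightarrow> fn set \<Rightarrow> real" where
  "recon_const S T = sqrt (real_of_ereal (upper_const S / lower_const S T))"

end

(* Sampling at the points w n with weights given by the midpoint cells is compared with the
   integral of |fhat|^2 over J, the union of these cells, which has length 2K and contains
   (-(K - 1/2), K - 1/2).  Wirtinger's inequality on both halves of each cell, applied to
   G t = fhat t * cis (pi t), bounds the L2 distance over J between G and its cellwise constant
   sampled version by delta / pi times the norm of G', and G' has norm at most pi |f|.  So the
   square root of <S f, f> differs from the norm of fhat over J by at most delta |f|.  Plancherel
   bounds the latter above by |f|, and below by sqrt (1 - E^2) |f| for f in T.
   Plancherel itself follows by integrating Parseval's identity for the modulations of f
   over t in [0,1]:  sum_n |fhat (n + t)|^2 = |f|^2. *)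
theory Submission
  imports Defs
begin

subsection \<open>Square-integrable functions on the unit interval\<close>

text \<open>Square roots are compared, not energies, because the triangle inequality then yields the
  factors 1 + \<delta> and sqrt (1 - E^2) - \<delta>. Their squares bound the two constants, and the
  reconstruction constant takes the root of the quotient. The error factor \<delta> leaves no slack:
  it needs the sharp one-endpoint Wirtinger constant on half cells together with the centring of the
  support. Differentiating the transform of the uncentred f costs 2 pi instead of pi and would give
  2 \<delta>. Bounded support carries the Fourier part. It puts f in L1, makes the transform
  differentiable, and turns the values at n + t into Fourier coefficients over one period.
  Plancherel thus reduces to density of trigonometric polynomials in L2 of [0,1], which rests on
  Stone-Weierstrass on the circle.\<close>

lemma cnj_borel_measurable [measurable (raw)]:
  assumes "f \<in> borel_measurable M"
  shows "(\<lambda>x. cnj (f x)) \<in> borel_measurable M"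
  by (rule measurable_compose[OF assms borel_measurable_continuous_onI]) (intro continuous_intros)

lemma HH_borel: "f \<in> HH \<Longrightarrow> f \<in> borel_measurable borel"
  by (simp add: HH_def)

lemma HH_square_integrable: "f \<in> HH \<Longrightarrow> integrable lborel (\<lambda>x. (cmod (f x))^2)"
  by (simp add: HH_def)

lemma HH_outside: "f \<in> HH \<Longrightarrow> x \<notin> {0..1} \<Longrightarrow> f x = 0"
  by (simp add: HH_def)

text \<open>The support has finite length and |z| \<le> 1 + |z|^2, so square integrability implies
  integrability. Hence \<open>fourier\<close> is a genuine Lebesgue integral on all of
  \<open>HH\<close>.\<close>

lemma HH_integrable:
  assumes "f \<in> HH"
  shows "integrable lborel f"
proof (rule Bochner_Integration.integrable_bound)
  show "integrable lborel (\<lambda>x. indicator {0..1} x + (cmod (f x))^2 :: real)"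
    by (intro Bochner_Integration.integrable_add HH_square_integrable assms) simp
  show "f \<in> borel_measurable lborel" using HH_borel[OF assms] by simp
  have "cmod (f x) \<le> norm (indicator {0..1} x + (cmod (f x))^2 :: real)" for x
  proof (cases "x \<in> {0..1}")
    case True
    have "cmod (f x) \<le> 1 + (cmod (f x))^2"
      using sum_squares_bound[of 1 "cmod (f x)"] norm_ge_zero[of "f x"]
      unfolding one_power2 by linarith
    then show ?thesis using True by simp
  qed (use HH_outside[OF assms] in simp)
  then show "AE x in lborel. cmod (f x) \<le> norm (indicator {0..1} x + (cmod (f x))^2 :: real)"
    by simp
qed

lemma HH_mult_integrable:
  assumes "f \<in> HH" "g \<in> HH"
  shows "integrable lborel (\<lambda>x. f x * cnj (g x))"
proof (rule Bochner_Integration.integrable_bound)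
  show "integrable lborel (\<lambda>x. (cmod (f x))^2 + (cmod (g x))^2)"
    by (intro Bochner_Integration.integrable_add HH_square_integrable assms)
  show "(\<lambda>x. f x * cnj (g x)) \<in> borel_measurable lborel"
    using HH_borel[OF assms(1)] HH_borel[OF assms(2)] by simp
  have "cmod (f x * cnj (g x)) \<le> norm ((cmod (f x))^2 + (cmod (g x))^2)" for x
    using sum_squares_bound[of "cmod (f x)" "cmod (g x)"]
      mult_nonneg_nonneg[OF norm_ge_zero[of "f x"] norm_ge_zero[of "g x"]]
    unfolding norm_mult complex_mod_cnj real_norm_def by linarith
  then show "AE x in lborel. cmod (f x * cnj (g x)) \<le> norm ((cmod (f x))^2 + (cmod (g x))^2)"
    by simp
qed

text \<open>The multiplier needs a bound on [0,1] only, so factors such as x are allowed. With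
  \<open>f\<close> the indicator of [0,1], the lemma also puts cut-off functions into
  \<open>HH\<close>.\<close>

lemma HH_mult:
  assumes f: "f \<in> HH" and u: "u \<in> borel_measurable borel"
    and B: "\<And>x. x \<in> {0..1} \<Longrightarrow> cmod (u x) \<le> B"
  shows "(\<lambda>x. u x * f x) \<in> HH"
proof -
  have "integrable lborel (\<lambda>x. (cmod (u x * f x))^2)"
  proof (rule Bochner_Integration.integrable_bound)
    show "integrable lborel (\<lambda>x. B^2 * (cmod (f x))^2)"
      by (intro integrable_mult_right HH_square_integrable f)
    show "(\<lambda>x. (cmod (u x * f x))^2) \<in> borel_measurable lborel"
      using HH_borel[OF f] u by simp
    have "(cmod (u x * f x))^2 \<le> B^2 * (cmod (f x))^2" for x
    proof (cases "x \<in> {0..1}")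
      case True
      then show ?thesis
        unfolding norm_mult power_mult_distrib
        using B by (intro mult_right_mono power_mono) auto
    qed (use HH_outside[OF f] in simp)
    then show "AE x in lborel. norm ((cmod (u x * f x))^2) \<le> norm (B^2 * (cmod (f x))^2)"
      by simp
  qed
  then show ?thesis
    using HH_borel[OF f] u HH_outside[OF f] by (auto simp: HH_def)
qed

lemma HH_indicator: "indicator {0..1} \<in> HH"
proof -
  have "(\<lambda>x. (cmod (indicator {0..1} x))\<^sup>2) = (indicator {0..1} :: real \<Rightarrow> real)"
    by (auto simp: indicator_def)
  then show ?thesis by (auto simp: HH_def)
qed

lemma HH_cmult: "f \<in> HH \<Longrightarrow> (\<lambda>x. c * f x) \<in> HH"
  by (rule HH_mult[where B = "cmod c"]) auto

lemma norm_add_square_le: "(norm (a + b))^2 \<le> 2 * (norm a)^2 + 2 * (norm b)^2"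
  for a b :: "'a :: real_normed_vector"
proof -
  have "(norm (a + b))^2 \<le> (norm a + norm b)^2"
    by (intro power_mono norm_triangle_ineq) simp
  then show ?thesis
    using sum_squares_bound[of "norm a" "norm b"] by (simp add: power2_sum)
qed

lemma HH_add:
  assumes "f \<in> HH" "g \<in> HH"
  shows "(\<lambda>x. f x + g x) \<in> HH"
proof -
  have "integrable lborel (\<lambda>x. (cmod (f x + g x))^2)"
  proof (rule Bochner_Integration.integrable_bound)
    show "integrable lborel (\<lambda>x. 2 * (cmod (f x))^2 + 2 * (cmod (g x))^2)"
      by (intro Bochner_Integration.integrable_add integrable_mult_right HH_square_integrable assms)
    show "(\<lambda>x. (cmod (f x + g x))^2) \<in> borel_measurable lborel"
      using HH_borel[OF assms(1)] HH_borel[OF assms(2)] by simp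
    show "AE x in lborel. norm ((cmod (f x + g x))^2)
        \<le> norm (2 * (cmod (f x))^2 + 2 * (cmod (g x))^2)"
      using norm_add_square_le[of "f _" "g _"] by simp
  qed
  then show ?thesis
    using HH_borel[OF assms(1)] HH_borel[OF assms(2)] HH_outside[OF assms(1)] HH_outside[OF assms(2)]
    by (auto simp: HH_def)
qed

lemma HH_diff: "f \<in> HH \<Longrightarrow> g \<in> HH \<Longrightarrow> (\<lambda>x. f x - g x) \<in> HH"
  using HH_add[of f "\<lambda>x. -1 * g x"] HH_cmult[of g "-1"] by simp

lemma norm_L2_square: "(norm_L2 f)^2 = (LINT x|lborel. (cmod (f x))^2)"
  by (simp add: norm_L2_def)

lemma norm_L2_nonneg: "norm_L2 f \<ge> 0"
  by (simp add: norm_L2_def)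

lemma inner_L2_self: "inner_L2 f f = complex_of_real ((norm_L2 f)^2)"
  unfolding norm_L2_square inner_L2_def
  by (subst integral_complex_of_real[symmetric]) (simp only: complex_norm_square)

lemma inner_L2_commute: "inner_L2 g f = cnj (inner_L2 f g)"
  unfolding inner_L2_def by (subst Bochner_Integration.integral_cnj[symmetric]) (simp add: mult.commute)

lemma norm_L2_diff_square:
  assumes "f \<in> HH" "g \<in> HH"
  shows "(norm_L2 (\<lambda>x. f x - g x))^2 = (norm_L2 f)^2 - 2 * Re (inner_L2 f g) + (norm_L2 g)^2"
proof -
  have "inner_L2 (\<lambda>x. f x - g x) (\<lambda>x. f x - g x)
      = inner_L2 f f - inner_L2 f g - (inner_L2 g f - inner_L2 g g)"
    unfolding inner_L2_def
    by (simp add: algebra_simps HH_mult_integrable assms)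
  then have "complex_of_real ((norm_L2 (\<lambda>x. f x - g x))^2)
      = of_real ((norm_L2 f)^2) - inner_L2 f g - (cnj (inner_L2 f g) - of_real ((norm_L2 g)^2))"
    by (simp only: inner_L2_self inner_L2_commute[of g f])
  from this[THEN arg_cong[of _ _ Re]] show ?thesis by (simp add: algebra_simps)
qed

lemma norm_L2_add_square_le:
  assumes "f \<in> HH" "g \<in> HH"
  shows "(norm_L2 (\<lambda>x. f x + g x))^2 \<le> 2 * (norm_L2 f)^2 + 2 * (norm_L2 g)^2"
proof -
  have "(norm_L2 (\<lambda>x. f x + g x))^2 \<le> (LINT x|lborel. 2 * (cmod (f x))^2 + 2 * (cmod (g x))^2)"
    unfolding norm_L2_square
    by (intro integral_mono HH_square_integrable HH_add Bochner_Integration.integrable_add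
        integrable_mult_right assms norm_add_square_le)
  also have "\<dots> = 2 * (norm_L2 f)^2 + 2 * (norm_L2 g)^2"
    unfolding norm_L2_square by (simp add: HH_square_integrable assms)
  finally show ?thesis .
qed

lemma norm_L2_cmult: "norm_L2 (\<lambda>x. c * f x) = cmod c * norm_L2 f"
  by (simp add: norm_L2_def norm_mult power_mult_distrib real_sqrt_mult)

lemma norm_L2_mult_le:
  assumes f: "f \<in> HH" and u: "u \<in> borel_measurable borel" and "B \<ge> 0"
    and B: "\<And>x. x \<in> {0..1} \<Longrightarrow> cmod (u x) \<le> B"
  shows "norm_L2 (\<lambda>x. u x * f x) \<le> B * norm_L2 f"
proof (rule power2_le_imp_le)
  have "(cmod (u x * f x))^2 \<le> B^2 * (cmod (f x))^2" for x
  proof (cases "x \<in> {0..1}")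
    case True
    then show ?thesis
      unfolding norm_mult power_mult_distrib
      using B by (intro mult_right_mono power_mono) auto
  qed (use HH_outside[OF f] in simp)
  then have "(norm_L2 (\<lambda>x. u x * f x))^2 \<le> (LINT x|lborel. B^2 * (cmod (f x))^2)"
    unfolding norm_L2_square
    by (intro integral_mono HH_square_integrable HH_mult[OF f u B] integrable_mult_right f) auto
  then show "(norm_L2 (\<lambda>x. u x * f x))^2 \<le> (B * norm_L2 f)^2"
    by (simp add: power_mult_distrib norm_L2_square)
qed (use \<open>B \<ge> 0\<close> norm_L2_nonneg in simp)

lemma cis_measurable [measurable]: "cis \<in> borel_measurable borel"
  by (intro borel_measurable_continuous_onI continuous_intros)

lemma fourier_integrable: "f \<in> HH \<Longrightarrow> integrable lborel (\<lambda>x. f x * cis (-2 * pi * w * x))"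
  using HH_integrable[OF HH_mult[of f "\<lambda>x. cis (-2 * pi * w * x)" 1]] by (simp add: mult.commute)

lemma fourier_add:
  "f \<in> HH \<Longrightarrow> g \<in> HH \<Longrightarrow> fourier (\<lambda>x. f x + g x) w = fourier f w + fourier g w"
  unfolding fourier_def distrib_right
  by (intro Bochner_Integration.integral_add fourier_integrable)

lemma fourier_cmult: "fourier (\<lambda>x. c * f x) w = c * fourier f w"
  unfolding fourier_def by (subst integral_mult_right_zero[symmetric]) (simp add: mult.assoc)

lemma fourier_modulate:
  "fourier (\<lambda>x. cis (-2 * pi * t * x) * f x) w = fourier f (w + t)"
proof -
  have "cis (-2 * pi * t * x) * f x * cis (-2 * pi * w * x) = f x * cis (-2 * pi * (w + t) * x)" for x
  proof -
    have "cis (-2 * pi * t * x) * cis (-2 * pi * w * x) = cis (-2 * pi * (w + t) * x)"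
      unfolding cis_mult by (simp add: algebra_simps)
    then show ?thesis by (metis mult.assoc mult.commute)
  qed
  then show ?thesis by (simp only: fourier_def)
qed

section \<open>Exponential sums on the unit interval and Bessel's inequality\<close>

definition exp_sum :: "int set \<Rightarrow> (int \<Rightarrow> complex) \<Rightarrow> fn" where
  "exp_sum I c x = (\<Sum>n\<in>I. c n * cis (2 * pi * n * x))"

lemma exp_sum_measurable [measurable]: "exp_sum I c \<in> borel_measurable borel"
  unfolding exp_sum_def[abs_def] by measurable

lemma norm_exp_sum_le: "cmod (exp_sum I c x) \<le> (\<Sum>n\<in>I. cmod (c n))"
  unfolding exp_sum_def by (rule order.trans[OF norm_sum]) (simp add: norm_mult)

lemma HH_exp_sum: "(\<lambda>x. exp_sum I c x * indicator {0..1} x) \<in> HH"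
  by (rule HH_mult[OF HH_indicator exp_sum_measurable norm_exp_sum_le])

lemma integral_cis_period:
  "(LINT x|lborel. indicator {0..1} x * cis (2 * pi * real_of_int n * x)) = (if n = 0 then 1 else 0)"
proof (cases "n = 0")
  case True
  then have "(\<lambda>x. indicator {0..1} x * cis (2 * pi * real_of_int n * x))
      = (\<lambda>x. complex_of_real (indicator {0..1} x))"
    by (auto simp: indicator_def)
  then show ?thesis using True by (simp only: integral_complex_of_real) simp
next
  case False
  let ?F = "\<lambda>x. cis (2 * pi * real_of_int n * x) / (2 * pi * real_of_int n * \<i>)"
  have "(LINT x|lborel. indicator {0..1} x *\<^sub>R cis (2 * pi * real_of_int n * x)) = ?F 1 - ?F 0"
  proof (rule integral_FTC_Icc)
    show "(?F has_vector_derivative cis (2 * pi * real_of_int n * x)) (at x within {0..1})" for x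
    proof -
      have "((\<lambda>x. exp (\<i> * (2 * pi * real_of_int n * x)) / (2 * pi * real_of_int n * \<i>))
          has_field_derivative exp (\<i> * (2 * pi * real_of_int n * x))) (at (of_real x))"
        using False by (auto intro!: derivative_eq_intros)
      from has_vector_derivative_real_field[OF this] show ?thesis
        by (simp add: cis_conv_exp has_vector_derivative_at_within)
    qed
    show "continuous_on {0..1} (\<lambda>x. cis (2 * pi * real_of_int n * x))"
      by (intro continuous_intros)
  qed simp
  also have "?F 1 - ?F 0 = 0"
    using cis_multiple_2pi[of "real_of_int n"] by (simp add: mult.commute)
  finally show ?thesis
    using False by (simp add: scaleR_conv_of_real of_real_indicator)
qed

lemma inner_L2_exp_sum:
  assumes "f \<in> HH" "finite I"
  shows "inner_L2 f (\<lambda>x. exp_sum I c x * indicator {0..1} x) = (\<Sum>n\<in>I. cnj (c n) * fourier f n)"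
proof -
  have "f x * cnj (exp_sum I c x * indicator {0..1} x)
      = (\<Sum>n\<in>I. cnj (c n) * (f x * cis (-2 * pi * n * x)))" for x
    using HH_outside[OF assms(1), of x]
    by (cases "x \<in> {0..1}") (simp_all add: exp_sum_def sum_distrib_left cis_cnj mult.left_commute)
  then show ?thesis
    unfolding inner_L2_def fourier_def
    using fourier_integrable[OF assms(1)]
    by (simp del: mult_minus_left cis_cnj)
qed

lemma fourier_exp_sum:
  assumes "finite I"
  shows "fourier (\<lambda>x. exp_sum I c x * indicator {0..1} x) (real_of_int m) = (if m \<in> I then c m else 0)"
proof -
  have eq: "exp_sum I c x * indicator {0..1} x * cis (-2 * pi * m * x)
      = (\<Sum>n\<in>I. c n * (indicator {0..1} x * cis (2 * pi * real_of_int (n - m) * x)))" for x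
  proof -
    have "cis (2 * pi * n * x) * cis (-2 * pi * m * x) = cis (2 * pi * real_of_int (n - m) * x)" for n
      unfolding cis_mult by (simp add: algebra_simps)
    then show ?thesis
      unfolding exp_sum_def sum_distrib_right
      by (intro sum.cong refl) (metis mult.assoc mult.commute)
  qed
  have int: "integrable lborel (\<lambda>x. indicator {0..1} x * cis (2 * pi * real_of_int n * x))" for n
    using fourier_integrable[OF HH_indicator, of "- real_of_int n"] by simp
  have "fourier (\<lambda>x. exp_sum I c x * indicator {0..1} x) (real_of_int m)
      = (\<Sum>n\<in>I. c n * (if n = m then 1 else 0))"
    unfolding fourier_def eq
    using int by (subst Bochner_Integration.integral_sum) (simp_all add: integral_cis_period del: of_int_diff)
  then show ?thesis using assms by (simp add: if_distrib cong: if_cong)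
qed

text \<open>Used in two ways. Taking \<open>c\<close> to be the Fourier coefficients removes the
  last sum and gives Bessel's inequality. Dropping the last sum for arbitrary \<open>c\<close>
  bounds the energy missed by the coefficients in \<open>I\<close> by the error of any approximant
  with frequencies in \<open>I\<close>.\<close>

lemma norm_L2_diff_exp_sum:
  assumes "f \<in> HH" "finite I"
  shows "(norm_L2 (\<lambda>x. f x - exp_sum I c x * indicator {0..1} x))^2
    = (norm_L2 f)^2 - (\<Sum>n\<in>I. (cmod (fourier f n))^2) + (\<Sum>n\<in>I. (cmod (fourier f n - c n))^2)"
proof -
  let ?p = "\<lambda>x. exp_sum I c x * indicator {0..1} x"
  have "inner_L2 ?p ?p = (\<Sum>n\<in>I. cnj (c n) * c n)"
    using inner_L2_exp_sum[OF HH_exp_sum assms(2), of I c c] fourier_exp_sum[OF assms(2), of c]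
    by simp
  then have p: "(norm_L2 ?p)^2 = Re (\<Sum>n\<in>I. cnj (c n) * c n)"
    unfolding inner_L2_self by (metis Re_complex_of_real)
  have "(cmod (fourier f n - c n))^2
      = (cmod (fourier f n))^2 - 2 * Re (cnj (c n) * fourier f n) + Re (cnj (c n) * c n)" for n
    by (simp only: cmod_power2) (simp add: power2_eq_square algebra_simps)
  then show ?thesis
    unfolding norm_L2_diff_square[OF assms(1) HH_exp_sum] p inner_L2_exp_sum[OF assms]
    by (simp add: sum.distrib sum_subtractf sum_distrib_left)
qed

lemma bessel:
  assumes "f \<in> HH" "finite I"
  shows "(\<Sum>n\<in>I. (cmod (fourier f (real_of_int n + t)))^2) \<le> (norm_L2 f)^2"
proof -
  let ?g = "\<lambda>x. cis (-2 * pi * t * x) * f x"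
  have g: "?g \<in> HH" by (rule HH_mult[OF assms(1), where B = 1]) auto
  have "norm_L2 ?g = norm_L2 f" by (simp add: norm_L2_def norm_mult)
  then show ?thesis
    using norm_L2_diff_exp_sum[OF g assms(2), of "fourier ?g"]
      zero_le_power2[of "norm_L2 (\<lambda>x. ?g x - exp_sum I (fourier ?g) x * indicator {0..1} x)"]
    unfolding fourier_modulate by simp
qed

text \<open>Bessel's inequality with the single index 0, shifted by \<open>w\<close>.\<close>

lemma norm_fourier_le:
  assumes "f \<in> HH"
  shows "cmod (fourier f w) \<le> norm_L2 f"
  using bessel[OF assms, of "{0}" w] norm_L2_nonneg[of f] by (simp add: abs_le_square_iff[symmetric])

subsection \<open>Density of trigonometric polynomials and Parseval\<close>

text \<open>An inductive form is convenient for closure under products, which matches the induction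
  over polynomial functions on the circle. Bessel's inequality works with \<open>exp_sum\<close>
  instead, so a conversion follows.\<close>

inductive trig_poly :: "fn \<Rightarrow> bool" where
  trig_poly_cis: "trig_poly (\<lambda>x. a * cis (2 * pi * real_of_int n * x))"
| trig_poly_add: "trig_poly p \<Longrightarrow> trig_poly q \<Longrightarrow> trig_poly (\<lambda>x. p x + q x)"

lemma trig_poly_const: "trig_poly (\<lambda>x. a)"
  using trig_poly_cis[of a 0] by simp

lemma trig_poly_mult:
  assumes "trig_poly p" "trig_poly q"
  shows "trig_poly (\<lambda>x. p x * q x)"
  using assms(1)
proof induction
  case (trig_poly_cis a n)
  from assms(2) show ?case
  proof induction
    case (trig_poly_cis b m)
    have "(a * cis (2 * pi * real_of_int n * x)) * (b * cis (2 * pi * real_of_int m * x))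
        = a * b * cis (2 * pi * real_of_int (n + m) * x)" for x
    proof -
      have "cis (2 * pi * real_of_int n * x) * cis (2 * pi * real_of_int m * x)
          = cis (2 * pi * real_of_int (n + m) * x)"
        unfolding cis_mult by (simp add: algebra_simps)
      then show ?thesis by (metis mult.assoc mult.commute)
    qed
    then show ?case using trig_poly.trig_poly_cis[of "a * b" "n + m"] by (simp only:)
  next
    case (trig_poly_add p q)
    then show ?case by (simp add: distrib_left trig_poly.trig_poly_add)
  qed
next
  case (trig_poly_add p1 p2)
  then show ?case by (simp add: distrib_right trig_poly.trig_poly_add)
qed

lemma trig_poly_exp_sum:
  assumes "trig_poly p"
  obtains I c where "finite I" "p = exp_sum I c"
  using assms
proof (induction arbitrary: thesis)
  case (trig_poly_cis a n)
  show ?case by (rule trig_poly_cis[of "{n}" "\<lambda>_. a"]) (auto simp: exp_sum_def)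
next
  case (trig_poly_add p q)
  obtain I c where I: "finite I" "p = exp_sum I c" using trig_poly_add.IH(1) by blast
  obtain J d where J: "finite J" "q = exp_sum J d" using trig_poly_add.IH(2) by blast
  \<comment> \<open>The index sets may overlap, so both coefficient families are extended by zero to
    the union and added.\<close>
  let ?e = "\<lambda>n. (if n \<in> I then c n else 0) + (if n \<in> J then d n else 0)"
  have "exp_sum I c x = (\<Sum>n\<in>I \<union> J. (if n \<in> I then c n else 0) * cis (2 * pi * n * x))" for x
    unfolding exp_sum_def using I J by (intro sum.mono_neutral_cong_left) auto
  moreover have "exp_sum J d x = (\<Sum>n\<in>I \<union> J. (if n \<in> J then d n else 0) * cis (2 * pi * n * x))" for x
    unfolding exp_sum_def using I J by (intro sum.mono_neutral_cong_left) auto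
  ultimately have "(\<lambda>x. p x + q x) = exp_sum (I \<union> J) ?e"
    unfolding I J by (auto simp: exp_sum_def distrib_right sum.distrib)
  then show ?case using trig_poly_add.prems I J by blast
qed

text \<open>Real polynomial functions on the plane are generated by constants and real-linear
  functionals. Only the latter need an argument: on the circle they are combinations of cosine and
  sine, hence of frequencies 1 and -1 by Euler's formulas.\<close>

lemma trig_poly_real_polynomial_function:
  fixes q :: "complex \<Rightarrow> real"
  assumes "real_polynomial_function q"
  shows "trig_poly (\<lambda>x. complex_of_real (q (cis (2 * pi * x))))"
  using assms
proof induction
  case (linear f)
  interpret bounded_linear f by fact
  have "complex_of_real (f (cis (2 * pi * x)))
      = (f 1 - \<i> * f \<i>) / 2 * cis (2 * pi * real_of_int 1 * x)
        + (f 1 + \<i> * f \<i>) / 2 * cis (2 * pi * real_of_int (-1) * x)" for x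
  proof -
    have "cis (2 * pi * x) = cos (2 * pi * x) *\<^sub>R 1 + sin (2 * pi * x) *\<^sub>R \<i>"
      by (simp add: complex_eq_iff)
    then have "f (cis (2 * pi * x)) = cos (2 * pi * x) * f 1 + sin (2 * pi * x) * f \<i>"
      by (simp only: add scaleR real_scaleR_def)
    then show ?thesis by (simp add: complex_eq_iff) (simp add: field_simps)
  qed
  then show ?case
    using trig_poly_add[OF trig_poly_cis[of "(f 1 - \<i> * f \<i>) / 2" 1]
        trig_poly_cis[of "(f 1 + \<i> * f \<i>) / 2" "-1"]] by simp
next
  case (const c)
  show ?case by (rule trig_poly_const)
qed (auto intro: trig_poly_add trig_poly_mult)

text \<open>Equal end values let \<open>h\<close> descend to a continuous function on the unit
  circle, where Stone-Weierstrass applies.\<close>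

lemma uniform_approx_trig_poly:
  fixes h :: fn
  assumes h: "continuous_on {0..1} h" "h 0 = h 1" and "\<epsilon> > 0"
  obtains p where "trig_poly p" "\<And>x. x \<in> {0..1} \<Longrightarrow> cmod (h x - p x) < \<epsilon>"
proof -
  let ?F = "h \<circ> (\<lambda>z. Arg2pi z / (2 * pi))"
  \<comment> \<open>The constant homotopy serves only to transport a loop to a circle map;
    continuity of \<open>?F\<close> is read off from the result.\<close>
  have "homotopic_loops UNIV h h"
    using h by (simp add: homotopic_loops_refl path_def pathfinish_def pathstart_def)
  then have "continuous_on (sphere 0 1) ?F"
    using homotopic_loops_imp_homotopic_circlemaps homotopic_with_imp_continuous by blast
  then obtain q where q: "polynomial_function q" "\<And>z. z \<in> sphere 0 1 \<Longrightarrow> cmod (?F z - q z) < \<epsilon>"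
    using Stone_Weierstrass_polynomial_function[OF compact_sphere _ \<open>\<epsilon> > 0\<close>] by metis
  let ?p = "\<lambda>x. q (cis (2 * pi * x))"
  have F: "?F (cis (2 * pi * x)) = h x" if "x \<in> {0..1}" for x
  \<comment> \<open>\<open>Arg2pi\<close> takes values in [0, 2 pi), so at x = 1 the circle map
    returns \<open>h 0\<close>, and the hypothesis \<open>h 0 = h 1\<close> is needed.\<close>
  proof (cases "x = 1")
    case True
    have "Arg2pi (cis (2 * pi)) = 0" using Arg2pi_of_real[of 1] by simp
    then show ?thesis using True h by simp
  next
    case False
    have "Arg2pi (exp (\<i> * (2 * pi * x))) = 2 * pi * x"
      using that False by (subst Arg2pi_exp) auto
    then show ?thesis by (simp add: cis_conv_exp)
  qed
  have "real_polynomial_function (Re \<circ> q)" "real_polynomial_function (Im \<circ> q)"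
    using q(1) bounded_linear_Re bounded_linear_Im unfolding polynomial_function_def by auto
  then have "trig_poly (\<lambda>x. complex_of_real ((Re \<circ> q) (cis (2 * pi * x)))
      + \<i> * complex_of_real ((Im \<circ> q) (cis (2 * pi * x))))"
    by (intro trig_poly_add trig_poly_mult trig_poly_const trig_poly_real_polynomial_function)
  moreover have "complex_of_real ((Re \<circ> q) (cis (2 * pi * x)))
      + \<i> * complex_of_real ((Im \<circ> q) (cis (2 * pi * x))) = ?p x" for x
    by (simp add: complex_eq_iff)
  ultimately have "trig_poly ?p" by simp
  then show ?thesis using that[of ?p] F q(2) by (metis dist_0_norm mem_sphere norm_cis)
qed

section \<open>Approximation in the L2 norm and Parseval's identity\<close>

lemma tendsto_norm_L2_diff:
  assumes f: "f \<in> HH" and g: "\<And>k. g k \<in> HH"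
    and w: "integrable lborel w" "\<And>k x. (cmod (f x - g k x))^2 \<le> w x"
    and lim: "AE x in lborel. (\<lambda>k. g k x) \<longlonglongrightarrow> f x"
  shows "(\<lambda>k. (norm_L2 (\<lambda>x. f x - g k x))^2) \<longlonglongrightarrow> 0"
proof -
  have "(\<lambda>k. LINT x|lborel. (cmod (f x - g k x))^2) \<longlonglongrightarrow> (LINT x::real|lborel. (0::real))"
  proof (rule integral_dominated_convergence[where w = w])
    show "(\<lambda>x. (cmod (f x - g k x))^2) \<in> borel_measurable lborel" for k
      using HH_borel[OF f] HH_borel[OF g[of k]] by simp
    show "AE x in lborel. (\<lambda>k. (cmod (f x - g k x))^2) \<longlonglongrightarrow> 0"
      using lim
    proof eventually_elim
      case (elim x)
      have "(\<lambda>k. (cmod (f x - g k x))^2) \<longlonglongrightarrow> (cmod (f x - f x))^2"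
        by (intro tendsto_intros elim)
      then show ?case by simp
    qed
  qed (use w in auto)
  then show ?thesis by (simp add: norm_L2_square)
qed

lemma approx_bounded:
  assumes f: "f \<in> HH" and "\<epsilon> > 0"
  obtains g M where "g \<in> HH" "M > 0" "\<And>x. cmod (g x) \<le> M" "(norm_L2 (\<lambda>x. f x - g x))^2 < \<epsilon>"
proof -
  let ?u = "\<lambda>k x. indicator {x. cmod (f x) \<le> real k} x :: complex"
  let ?g = "\<lambda>k x. ?u k x * f x"
  have g: "?g k \<in> HH" for k
    using HH_borel[OF f] by (intro HH_mult[OF f, where B = 1]) (auto simp: indicator_def)
  have "(\<lambda>k. (norm_L2 (\<lambda>x. f x - ?g k x))^2) \<longlonglongrightarrow> 0"
  proof (rule tendsto_norm_L2_diff[OF f g HH_square_integrable[OF f]])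
    show "(cmod (f x - ?g k x))^2 \<le> (cmod (f x))^2" for k x
      by (auto simp: indicator_def)
    show "AE x in lborel. (\<lambda>k. ?g k x) \<longlonglongrightarrow> f x"
    proof (intro AE_I2 tendsto_eventually)
      fix x
      obtain k0 :: nat where "cmod (f x) \<le> k0" using real_arch_simple by blast
      then show "\<forall>\<^sub>F k in sequentially. ?g k x = f x"
        by (intro eventually_sequentiallyI[of k0]) (auto simp: indicator_def)
    qed
  qed
  then obtain k where "(norm_L2 (\<lambda>x. f x - ?g k x))^2 < \<epsilon>"
    using order_tendstoD(2)[OF _ \<open>\<epsilon> > 0\<close>] eventually_sequentially by (metis (lifting) order_refl)
  \<comment> \<open>Adding 1 keeps the bound positive when \<open>k\<close> is 0.\<close>
  moreover have "cmod (?g k x) \<le> real k + 1" for x by (auto simp: indicator_def)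
  ultimately show ?thesis using g[of k] that[of "?g k" "real k + 1"] by auto
qed

text \<open>Measurability in the gauge-integral sense supplies continuous functions converging to
  \<open>f\<close> off a negligible set. They are modified to be uniformly bounded, so that
  dominated convergence applies, and to vanish at 0 and 1.\<close>

lemma approx_continuous_loop:
  assumes f: "f \<in> HH" and M: "M > 0" "\<And>x. cmod (f x) \<le> M" and "\<epsilon> > 0"
  obtains h where "continuous_on UNIV h" "h 0 = 0" "h 1 = 0"
    "(norm_L2 (\<lambda>x. f x - h x * indicator {0..1} x))^2 < \<epsilon>"
proof -
  have "f measurable_on UNIV"
    using HH_borel[OF f] by (intro lebesgue_measurable_imp_measurable_on) (auto simp: measurable_completion)
  then obtain N g where N: "negligible N" and g: "\<And>k. continuous_on UNIV (g k)"
    "\<And>x. x \<notin> N \<Longrightarrow> (\<lambda>k. g k x) \<longlonglongrightarrow> f x"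
    unfolding measurable_on_def by auto
  \<comment> \<open>Radial retraction onto the disc of radius \<open>M\<close>. It fixes the values
    of \<open>f\<close>, so the limit is unchanged.\<close>
  define r where "r k x = complex_of_real (M / max M (cmod (g k x))) * g k x" for k :: nat and x
  \<comment> \<open>A continuous cutoff, zero at both ends and eventually equal to 1 at each
    interior point.\<close>
  define u where "u k x = max 0 (min 1 (real k * x * (1 - x)))" for k :: nat and x :: real
  define h where "h k x = complex_of_real (u k x) * r k x" for k x
  have cont: "continuous_on UNIV (h k)" for k
    unfolding h_def u_def r_def using M(1) by (intro continuous_intros g) auto
  have r: "cmod (r k x) \<le> M" for k x
    using M(1) unfolding r_def norm_mult norm_of_real
    by (cases "cmod (g k x) \<le> M") (auto simp: max_def field_simps)
  have u: "\<bar>u k x\<bar> \<le> 1" for k x by (auto simp: u_def)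
  have h: "cmod (h k x) \<le> M" for k x
    unfolding h_def norm_mult norm_of_real using mult_mono[OF u r[of k x]] by simp
  have hm: "h k \<in> borel_measurable borel" for k
    using cont by (intro borel_measurable_continuous_onI)
  let ?h = "\<lambda>k x. h k x * indicator {0..1} x"
  have HHh: "?h k \<in> HH" for k
    by (rule HH_mult[OF HH_indicator hm, where B = M]) (use h in auto)
  have "(\<lambda>k. (norm_L2 (\<lambda>x. f x - ?h k x))^2) \<longlonglongrightarrow> 0"
  proof (rule tendsto_norm_L2_diff[OF f HHh])
    show "integrable lborel (\<lambda>x. (2 * M)^2 * indicator {0..1::real} x)" by simp
    show "(cmod (f x - ?h k x))^2 \<le> (2 * M)^2 * indicator {0..1} x" for k x
    proof (cases "x \<in> {0..1}")
      case True
      have "cmod (f x - h k x) \<le> 2 * M"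
        using norm_triangle_ineq4[of "f x" "h k x"] M(2)[of x] h[of k x] by linarith
      then show ?thesis using True power_mono[OF _ norm_ge_zero, of _ _ 2] by fastforce
    qed (use HH_outside[OF f] in simp)
    have "negligible (N \<union> {0, 1})" using N by (intro negligible_Un) auto
    then have "AE x in lebesgue. x \<notin> N \<union> {0, 1}"
      unfolding negligible_iff_null_sets by (rule AE_not_in)
    then have "AE x in lborel. x \<notin> N \<union> {0, 1}" by (simp only: AE_completion_iff)
    then show "AE x in lborel. (\<lambda>k. ?h k x) \<longlonglongrightarrow> f x"
    proof eventually_elim
      case (elim x)
      show ?case
      proof (cases "x \<in> {0..1}")
        case True
        have "(\<lambda>k. r k x) \<longlonglongrightarrow> complex_of_real (M / max M (cmod (f x))) * f x"
          unfolding r_def using M(1) elim by (intro tendsto_intros g(2)) auto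
        then have rl: "(\<lambda>k. r k x) \<longlonglongrightarrow> f x" using M(2)[of x] M(1) by (simp add: max_def)
        have pos: "0 < x * (1 - x)" using True elim by (auto intro: mult_pos_pos)
        then obtain k0 :: nat where k0: "1 / (x * (1 - x)) \<le> k0" using real_arch_simple by blast
        have "u k x = 1" if "k0 \<le> k" for k
        proof -
          have "1 / (x * (1 - x)) \<le> real k" using k0 that by linarith
          then show ?thesis using pos by (simp add: u_def pos_divide_le_eq mult.assoc)
        qed
        then have "\<forall>\<^sub>F k in sequentially. r k x = ?h k x"
          using True by (intro eventually_sequentiallyI[of k0]) (simp add: h_def)
        then show ?thesis using rl by (rule Lim_transform_eventually[rotated])
      qed (use HH_outside[OF f] in simp)
    qed
  qed
  then obtain k where "(norm_L2 (\<lambda>x. f x - ?h k x))^2 < \<epsilon>"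
    using order_tendstoD(2)[OF _ \<open>\<epsilon> > 0\<close>] eventually_sequentially by (metis (lifting) order_refl)
  moreover have "h k 0 = 0" "h k 1 = 0" by (auto simp: h_def u_def)
  ultimately show ?thesis using that cont by blast
qed

lemma approx_exp_sum:
  assumes f: "f \<in> HH" and "\<epsilon> > 0"
  obtains I c where "finite I" "(norm_L2 (\<lambda>x. f x - exp_sum I c x * indicator {0..1} x))^2 < \<epsilon>"
proof -
  \<comment> \<open>Two uses of |a + b|^2 \<le> 2 |a|^2 + 2 |b|^2 over three errors give the total
    weight 2 + 4 + 4 = 10 < 16.\<close>
  have e: "\<epsilon> / 16 > 0" using \<open>\<epsilon> > 0\<close> by simp
  obtain g M where g: "g \<in> HH" "M > 0" "\<And>x. cmod (g x) \<le> M"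
    "(norm_L2 (\<lambda>x. f x - g x))^2 < \<epsilon> / 16"
    using approx_bounded[OF f e] by metis
  obtain h where h: "continuous_on UNIV h" "h 0 = 0" "h 1 = 0"
    "(norm_L2 (\<lambda>x. g x - h x * indicator {0..1} x))^2 < \<epsilon> / 16"
    using approx_continuous_loop[OF g(1-3) e] by metis
  have "sqrt (\<epsilon> / 16) > 0" using e by simp
  then obtain p where p: "trig_poly p" "\<And>x. x \<in> {0..1} \<Longrightarrow> cmod (h x - p x) < sqrt (\<epsilon> / 16)"
    using uniform_approx_trig_poly[of h "sqrt (\<epsilon> / 16)"] h continuous_on_subset by (metis subset_UNIV)
  obtain I c where I: "finite I" "p = exp_sum I c" using trig_poly_exp_sum[OF p(1)] by metis
  let ?h = "\<lambda>x. h x * indicator {0..1} x" and ?p = "\<lambda>x. exp_sum I c x * indicator {0..1} x"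
  have "bounded (h ` {0..1})"
    using h(1) continuous_on_subset by (intro compact_imp_bounded compact_continuous_image) auto
  then obtain B where "\<And>x. x \<in> {0..1} \<Longrightarrow> cmod (h x) \<le> B" unfolding bounded_iff by blast
  then have hH: "?h \<in> HH"
    using h(1) by (intro HH_mult[OF HH_indicator] borel_measurable_continuous_onI)
  note pH = HH_exp_sum[of I c]
  have "(norm_L2 (\<lambda>x. ?h x - ?p x))^2 \<le> (LINT x|lborel. \<epsilon> / 16 * indicator {0..1::real} x)"
    unfolding norm_L2_square
  proof (intro integral_mono HH_square_integrable HH_diff hH pH)
    fix x :: real
    show "(cmod (?h x - ?p x))^2 \<le> \<epsilon> / 16 * indicator {0..1} x"
    proof (cases "x \<in> {0..1}")
      case True
      then have "(cmod (h x - p x))^2 \<le> (sqrt (\<epsilon> / 16))^2"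
        using p(2) by (intro power_mono) (auto intro: less_imp_le)
      then show ?thesis using True e I by simp
    qed simp
  qed simp
  then have hp: "(norm_L2 (\<lambda>x. ?h x - ?p x))^2 \<le> \<epsilon> / 16" by simp
  have "(norm_L2 (\<lambda>x. f x - ?p x))^2
      \<le> 2 * (norm_L2 (\<lambda>x. f x - g x))^2 + 2 * (norm_L2 (\<lambda>x. g x - ?p x))^2"
    using norm_L2_add_square_le[OF HH_diff[OF f g(1)] HH_diff[OF g(1) pH]] by simp
  moreover have "(norm_L2 (\<lambda>x. g x - ?p x))^2
      \<le> 2 * (norm_L2 (\<lambda>x. g x - ?h x))^2 + 2 * (norm_L2 (\<lambda>x. ?h x - ?p x))^2"
    using norm_L2_add_square_le[OF HH_diff[OF g(1) hH] HH_diff[OF hH pH]] by simp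
  ultimately have "(norm_L2 (\<lambda>x. f x - ?p x))^2 < \<epsilon>" using g(4) h(4) hp \<open>\<epsilon> > 0\<close> by linarith
  then show ?thesis using that I by blast
qed

text \<open>Density makes the missing energy small for some finite index set, Bessel's inequality
  bounds the partial sums above, and enlarging the set only helps. The half-open blocks are chosen
  so that the unit intervals starting at their points tile [-m, m].\<close>

lemma parseval:
  assumes f: "f \<in> HH"
  shows "(\<lambda>m. \<Sum>n\<in>{- int m..<int m}. (cmod (fourier f (real_of_int n + t)))^2) \<longlonglongrightarrow> (norm_L2 f)^2"
proof (rule LIMSEQ_I)
  fix \<epsilon> :: real assume "\<epsilon> > 0"
  let ?g = "\<lambda>x. cis (-2 * pi * t * x) * f x"
  have g: "?g \<in> HH" by (rule HH_mult[OF f, where B = 1]) auto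
  have ng: "norm_L2 ?g = norm_L2 f" by (simp add: norm_L2_def norm_mult)
  obtain I c where I: "finite I"
    "(norm_L2 (\<lambda>x. ?g x - exp_sum I c x * indicator {0..1} x))^2 < \<epsilon>"
    using approx_exp_sum[OF g \<open>\<epsilon> > 0\<close>] by metis
  let ?a = "\<lambda>n. (cmod (fourier f (real_of_int n + t)))^2"
  \<comment> \<open>The discarded sum is the squared distance between the coefficients of
    \<open>?g\<close> and those of the approximant.\<close>
  have lower: "(norm_L2 f)^2 - (\<Sum>n\<in>I. ?a n) < \<epsilon>"
    using I norm_L2_diff_exp_sum[OF g I(1), of c] sum_nonneg[of I "\<lambda>n. (cmod (fourier ?g n - c n))^2"]
    unfolding fourier_modulate ng by simp
  obtain m0 :: nat where m0: "I \<subseteq> {- int m0..<int m0}"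
  proof
    show "I \<subseteq> {- int (nat (Max (insert 0 (abs ` I))) + 1)..<int (nat (Max (insert 0 (abs ` I))) + 1)}"
    proof
      fix n assume "n \<in> I"
      then have "\<bar>n\<bar> \<le> Max (insert 0 (abs ` I))" using I(1) by (intro Max_ge) auto
      then show "n \<in> {- int (nat (Max (insert 0 (abs ` I))) + 1)..<int (nat (Max (insert 0 (abs ` I))) + 1)}"
        by auto
    qed
  qed
  have "norm ((\<Sum>n\<in>{- int m..<int m}. ?a n) - (norm_L2 f)^2) < \<epsilon>" if "m \<ge> m0" for m
  proof -
    have "(\<Sum>n\<in>I. ?a n) \<le> (\<Sum>n\<in>{- int m..<int m}. ?a n)"
      using m0 that by (intro sum_mono2) auto
    moreover have "(\<Sum>n\<in>{- int m..<int m}. ?a n) \<le> (norm_L2 f)^2"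
      by (rule bessel[OF f]) simp
    ultimately show ?thesis using lower by simp
  qed
  then show "\<exists>m0. \<forall>m\<ge>m0. norm ((\<Sum>n\<in>{- int m..<int m}. ?a n) - (norm_L2 f)^2) < \<epsilon>" by blast
qed

subsection \<open>The Fourier transform and Plancherel\<close>

text \<open>Taylor's formula along the imaginary axis, where the exponential has modulus 1.\<close>

lemma cis_taylor: "cmod (cis \<theta> - 1 - \<i> * \<theta>) \<le> \<theta>^2"
proof -
  have "cmod (exp (\<i> * \<theta>) - (\<Sum>i\<le>1. exp 0 * (\<i> * \<theta> - 0)^i / fact i))
      \<le> 1 * cmod (\<i> * \<theta> - 0)^(Suc 1) / fact 1"
  proof (rule complex_Taylor[where S = "range (\<lambda>t. \<i> * complex_of_real t)" and f = "\<lambda>_. exp"])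
    show "convex (range (\<lambda>t. \<i> * complex_of_real t))"
      by (intro convex_linear_image) (auto intro!: linearI simp: algebra_simps scaleR_conv_of_real)
    show "0 \<in> range (\<lambda>t. \<i> * complex_of_real t)" by (auto intro!: image_eqI[of _ _ 0])
  qed (auto intro: DERIV_exp has_field_derivative_at_within)
  then show ?thesis by (simp add: cis_conv_exp norm_mult algebra_simps power2_eq_square)
qed

text \<open>Differentiation under the integral with an explicit remainder: since |x| \<le> 1 on the
  support, \<open>cis_taylor\<close> gives a pointwise error of order |y - w|^2 times the integrable
  function |f|.\<close>

lemma fourier_has_vector_derivative:
  assumes f: "f \<in> HH"
  shows "(fourier f has_vector_derivative fourier (\<lambda>x. (-2 * pi * \<i> * of_real x) * f x) w) (at w)"
  unfolding has_vector_derivative_def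
proof (rule has_derivativeI_sandwich[where e = 1])
  let ?u = "\<lambda>x. -2 * pi * \<i> * of_real x"
  have u: "(\<lambda>x. ?u x * f x) \<in> HH"
    by (rule HH_mult[OF f, where B = "2 * pi"]) (auto simp: norm_mult)
  let ?C = "LINT x|lborel. (2 * pi)^2 * cmod (f x)"
  fix y
  let ?r = "\<lambda>x. f x * cis (-2 * pi * y * x) - f x * cis (-2 * pi * w * x)
      - (y - w) *\<^sub>R (?u x * f x * cis (-2 * pi * w * x))"
  have bound: "cmod (?r x) \<le> \<bar>y - w\<bar>^2 * ((2 * pi)^2 * cmod (f x))" for x
  proof (cases "x \<in> {0..1}")
    case True
    let ?t = "-2 * pi * (y - w) * x"
    have "cis (-2 * pi * y * x) = cis (-2 * pi * w * x) * cis ?t"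
      unfolding cis_mult by (simp add: algebra_simps)
    then have "?r x = f x * cis (-2 * pi * w * x) * (cis ?t - 1 - \<i> * ?t)"
      by (simp only:) (simp add: scaleR_conv_of_real algebra_simps)
    then have "cmod (?r x) \<le> cmod (f x) * ?t^2"
      using cis_taylor[of ?t] by (simp only: norm_mult norm_cis mult_1_right) (intro mult_left_mono, auto)
    also have "\<dots> \<le> cmod (f x) * (\<bar>y - w\<bar>^2 * (2 * pi)^2)"
    proof (rule mult_left_mono)
      show "?t^2 \<le> \<bar>y - w\<bar>^2 * (2 * pi)^2"
        using True power_le_one[of x 2] unfolding power_mult_distrib power2_abs
        by (simp add: mult_right_le_one_le mult_left_le_one_le)
    qed simp
    also have "\<dots> = \<bar>y - w\<bar>^2 * ((2 * pi)^2 * cmod (f x))" by (simp only: mult_ac)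
    finally show ?thesis .
  qed (use HH_outside[OF f] in simp)
  have int: "integrable lborel (\<lambda>x. f x * cis (-2 * pi * v * x))"
    "integrable lborel (\<lambda>x. ?u x * f x * cis (-2 * pi * v * x))" for v
    using fourier_integrable[OF f, of v] fourier_integrable[OF u, of v] by simp_all
  have eq: "fourier f y - fourier f w - (y - w) *\<^sub>R fourier (\<lambda>x. ?u x * f x) w = (LINT x|lborel. ?r x)"
    unfolding fourier_def
    by (simp only: Bochner_Integration.integral_diff Bochner_Integration.integrable_diff
        integral_scaleR_right integrable_scaleR_right int)
  have "cmod (LINT x|lborel. ?r x) \<le> (LINT x|lborel. \<bar>y - w\<bar>^2 * ((2 * pi)^2 * cmod (f x)))"
    by (intro order.trans[OF Bochner_Integration.integral_norm_bound integral_mono] bound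
        Bochner_Integration.integrable_diff integrable_scaleR_right int integrable_mult_right
        integrable_norm HH_integrable f)
  then have *: "cmod (fourier f y - fourier f w - (y - w) *\<^sub>R fourier (\<lambda>x. ?u x * f x) w)
      \<le> \<bar>y - w\<bar>^2 * ?C"
    unfolding eq integral_mult_right_zero .
  assume "y \<noteq> w"
  then show "cmod (fourier f y - fourier f w - (y - w) *\<^sub>R fourier (\<lambda>x. ?u x * f x) w) / norm (y - w)
      \<le> \<bar>y - w\<bar> * ?C"
    using * by (simp add: divide_le_eq power2_eq_square mult_ac)
next
  have "((\<lambda>y. \<bar>y - w\<bar> * (LINT x|lborel. (2 * pi)^2 * cmod (f x)))
      \<longlongrightarrow> \<bar>w - w\<bar> * (LINT x|lborel. (2 * pi)^2 * cmod (f x))) (at w)"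
    by (intro tendsto_intros)
  then show "((\<lambda>y. \<bar>y - w\<bar> * (LINT x|lborel. (2 * pi)^2 * cmod (f x))) \<longlongrightarrow> 0) (at w)" by simp
qed (auto intro: bounded_linear_intros)

lemma continuous_on_fourier:
  assumes "f \<in> HH"
  shows "continuous_on S (fourier f)"
  by (rule continuous_on_vector_derivative[OF has_vector_derivative_at_within[OF fourier_has_vector_derivative[OF assms]]])

lemma integral_sum_translates:
  fixes F :: "real \<Rightarrow> real"
  assumes F: "continuous_on UNIV F"
  shows "integral {0..1} (\<lambda>t. \<Sum>n\<in>{- int m..<int m}. F (real_of_int n + t)) = integral {- real m..real m} F"
proof (induction m)
  case (Suc m)
  have int: "F integrable_on {a..b}" for a b
    using F by (intro integrable_continuous_real continuous_on_subset[OF F]) auto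
  have sh: "(\<lambda>t. F (a + t)) integrable_on {0..1}" for a
    by (intro integrable_continuous_real continuous_on_compose2[OF F] continuous_intros) auto
  have shift: "integral {0..1} (\<lambda>t. F (a + t)) = integral {a..a + 1} F" for a
    using integral_shift_Icc_real[of 0 1 F a] by (simp add: o_def add.commute)
  have "{- int (Suc m)..<int (Suc m)} = insert (- int m - 1) (insert (int m) {- int m..<int m})" by auto
  then have "integral {0..1} (\<lambda>t. \<Sum>n\<in>{- int (Suc m)..<int (Suc m)}. F (real_of_int n + t))
      = integral {0..1} (\<lambda>t. F (- real m - 1 + t) + (F (real m + t)
          + (\<Sum>n\<in>{- int m..<int m}. F (real_of_int n + t))))"
    by simp
  also have "\<dots> = integral {- real m - 1..- real m} F
      + (integral {real m..real m + 1} F + integral {- real m..real m} F)"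
    using shift[of "- real m - 1"] shift[of "real m"]
    by (simp add: Henstock_Kurzweil_Integration.integral_add sh integrable_add integrable_sum Suc.IH)
  also have "\<dots> = integral {- real m - 1..real m + 1} F"
    using Henstock_Kurzweil_Integration.integral_combine[of "- real m - 1" "- real m" "real m + 1" F]
      Henstock_Kurzweil_Integration.integral_combine[of "- real m" "real m" "real m + 1" F] int by simp
  also have "{- real m - 1..real m + 1} = {- real (Suc m)..real (Suc m)}" by auto
  finally show ?case .
qed simp

lemma plancherel:
  assumes f: "f \<in> HH"
  shows "integrable lborel (\<lambda>w. (cmod (fourier f w))^2)"
    and "(LINT w|lborel. (cmod (fourier f w))^2) = (norm_L2 f)^2"
proof -
  let ?F = "\<lambda>w. (cmod (fourier f w))^2"
  have F: "continuous_on S ?F" for S by (intro continuous_intros continuous_on_fourier f)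
  let ?S = "\<lambda>m t. \<Sum>n\<in>{- int m..<int m}. ?F (real_of_int n + t)"
  have "(\<lambda>m. integral {0..1} (?S m)) \<longlonglongrightarrow> integral {0..1::real} (\<lambda>t. (norm_L2 f)^2)"
  \<comment> \<open>Bessel's inequality provides the constant majorant, uniform in \<open>m\<close>
    and \<open>t\<close>.\<close>
  proof (rule dominated_convergence)
    show "?S m integrable_on {0..1}" for m
      by (intro integrable_continuous_real continuous_intros continuous_on_compose2[OF F]) auto
    show "norm (?S m t) \<le> (norm_L2 f)^2" for m t
      using bessel[OF f, of "{- int m..<int m}" t] by (simp add: sum_nonneg)
  qed (use parseval[OF f] in auto)
  then have lim: "(\<lambda>m. integral {- real m..real m} ?F) \<longlonglongrightarrow> (norm_L2 f)^2"
    unfolding integral_sum_translates[OF F] by simp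
  have int: "set_integrable lborel {- real m..real m} ?F" for m
    by (rule borel_integrable_atLeastAtMost'[OF F])
  let ?G = "\<lambda>m w. indicator {- real m..real m} w *\<^sub>R ?F w"
  have G: "integrable lborel (?G m)" for m using int[of m] by (simp add: set_integrable_def)
  have lim1: "(\<lambda>m. LINT w|lborel. ?G m w) \<longlonglongrightarrow> (norm_L2 f)^2"
    using lim set_borel_integral_eq_integral(2)[OF int] by (simp add: set_lebesgue_integral_def)
  have mono: "AE w in lborel. mono (\<lambda>m. ?G m w)"
    by (intro AE_I2 monoI) (auto simp: indicator_def)
  have nonneg: "\<And>m. AE w in lborel. 0 \<le> ?G m w" by simp
  have lim2: "AE w in lborel. (\<lambda>m. ?G m w) \<longlonglongrightarrow> ?F w"
  proof (intro AE_I2 tendsto_eventually)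
    fix w :: real
    obtain m0 :: nat where "\<bar>w\<bar> \<le> m0" using real_arch_simple by blast
    then show "\<forall>\<^sub>F m in sequentially. ?G m w = ?F w"
      by (intro eventually_sequentiallyI[of m0]) (auto simp: indicator_def)
  qed
  have meas: "?F \<in> borel_measurable lborel"
    using borel_measurable_continuous_onI[OF F] by simp
  \<comment> \<open>Integrability on the whole line is an output here: monotone convergence derives
    it from the finite limit of the integrals over [-m, m].\<close>
  show "integrable lborel ?F" "(LINT w|lborel. ?F w) = (norm_L2 f)^2"
    by (rule integral_monotone_convergence_nonneg[OF G mono nonneg lim2 lim1 meas])+
qed

subsection \<open>Wirtinger's inequality with one vanishing endpoint\<close>

text \<open>Completing the square: with \<open>q' = - c\<^sup>2 - q\<^sup>2\<close> the derivative of \<open>\<bar>g\<bar>\<^sup>2 q\<close> is at most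
  \<open>\<bar>g'\<bar>\<^sup>2 - c\<^sup>2 \<bar>g\<bar>\<^sup>2\<close>. The choice \<open>q t = c tan (c (b - t))\<close> vanishes at \<open>b\<close> and is regular on
  the closed interval only for \<open>c\<close> strictly below the sharp constant.\<close>

lemma wirtinger_aux:
  fixes g g' :: "real \<Rightarrow> complex"
  assumes "a \<le> b" "c > 0" "c * (b - a) < pi / 2"
    and g: "\<And>t. t \<in> {a..b} \<Longrightarrow> (g has_vector_derivative g' t) (at t within {a..b})"
    and g': "continuous_on {a..b} g'" and "g a = 0"
  shows "c^2 * integral {a..b} (\<lambda>t. (cmod (g t))^2) \<le> integral {a..b} (\<lambda>t. (cmod (g' t))^2)"
proof -
  define q where "q t = c * tan (c * (b - t))" for t
  have cosne: "cos (c * (b - t)) \<noteq> 0" if "t \<in> {a..b}" for t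
  proof -
    have "0 \<le> c * (b - t)" "c * (b - t) \<le> c * (b - a)" using that \<open>c > 0\<close> by auto
    then have "cos (c * (b - t)) > 0" using assms(3) by (intro cos_gt_zero_pi) auto
    then show ?thesis by simp
  qed
  have q: "(q has_field_derivative (- (c^2) - (q t)^2)) (at t within {a..b})" if "t \<in> {a..b}" for t
  proof -
    have "(q has_field_derivative c * (- c * inverse ((cos (c * (b - t)))^2))) (at t within {a..b})"
      unfolding q_def using cosne[OF that] by (auto intro!: derivative_eq_intros)
    also have "inverse ((cos (c * (b - t)))^2) = 1 + (tan (c * (b - t)))^2"
      using tan_sec[OF cosne[OF that]] by (simp add: power_inverse)
    also have "c * (- c * (1 + (tan (c * (b - t)))^2)) = - (c^2) - (q t)^2"
      by (simp add: q_def power2_eq_square algebra_simps)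
    finally show ?thesis .
  qed
  let ?D = "\<lambda>t. 2 * (g t \<bullet> g' t) * q t - (cmod (g t))^2 * (c^2 + (q t)^2)"
  have "((\<lambda>t. (g t \<bullet> g t) * q t) has_vector_derivative ?D t) (at t within {a..b})"
    if "t \<in> {a..b}" for t
  proof -
    have "((\<lambda>t. g t \<bullet> g t) has_vector_derivative 2 * (g t \<bullet> g' t)) (at t within {a..b})"
      using bounded_bilinear.has_vector_derivative[OF bounded_bilinear_inner g[OF that] g[OF that]]
      by (simp add: inner_commute)
    from has_vector_derivative_mult[OF this q[OF that, unfolded has_real_derivative_iff_has_vector_derivative]]
    show ?thesis by (simp add: dot_square_norm algebra_simps)
  qed
  then have "(?D has_integral (g b \<bullet> g b) * q b - (g a \<bullet> g a) * q a) {a..b}"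
    by (rule fundamental_theorem_of_calculus[OF \<open>a \<le> b\<close>])
  \<comment> \<open>The boundary terms vanish for different reasons: \<open>g a = 0\<close> on the
    left, and \<open>tan 0 = 0\<close> in \<open>q b\<close> on the right, where \<open>g b\<close>
    is free.\<close>
  then have D: "(?D has_integral 0) {a..b}" using \<open>g a = 0\<close> by (simp add: q_def)
  have cg: "continuous_on {a..b} g"
    using g by (intro continuous_on_vector_derivative)
  have int: "(\<lambda>t. (cmod (g' t))^2) integrable_on {a..b}" "(\<lambda>t. c^2 * (cmod (g t))^2) integrable_on {a..b}"
    by (intro integrable_continuous_real continuous_intros g' cg)+
  have "?D t \<le> (cmod (g' t))^2 - c^2 * (cmod (g t))^2" for t
  proof -
    have "0 \<le> (cmod (g' t - q t *\<^sub>R g t))^2" by simp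
    also have "\<dots> = (cmod (g' t))^2 - 2 * (g t \<bullet> g' t) * q t + (q t)^2 * (cmod (g t))^2"
      unfolding power2_norm_eq_inner by (simp add: inner_diff inner_commute power2_eq_square algebra_simps)
    finally show ?thesis by (simp add: algebra_simps)
  qed
  then have "0 \<le> integral {a..b} (\<lambda>t. (cmod (g' t))^2 - c^2 * (cmod (g t))^2)"
    by (rule has_integral_le[OF D integrable_integral[OF integrable_diff[OF int]]])
  then show ?thesis using int by (simp add: integral_diff)
qed

text \<open>On an interval of length at most d/2 every c < pi/d is admissible in
  \<open>wirtinger_aux\<close>. Both sides are continuous in c, so the endpoint pi/d is reached as a
  limit.\<close>

lemma wirtinger_left:
  fixes g g' :: "real \<Rightarrow> complex"
  assumes "a \<le> b" "2 * (b - a) \<le> d" "d > 0"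
    and g: "\<And>t. t \<in> {a..b} \<Longrightarrow> (g has_vector_derivative g' t) (at t within {a..b})"
    and g': "continuous_on {a..b} g'" and "g a = 0"
  shows "integral {a..b} (\<lambda>t. (cmod (g t))^2) \<le> (d / pi)^2 * integral {a..b} (\<lambda>t. (cmod (g' t))^2)"
proof -
  let ?A = "integral {a..b} (\<lambda>t. (cmod (g t))^2)" and ?B = "integral {a..b} (\<lambda>t. (cmod (g' t))^2)"
  have le: "c^2 * ?A \<le> ?B" if "c \<in> {0<..<pi / d}" for c
  proof (rule wirtinger_aux[OF \<open>a \<le> b\<close> _ _ g g' \<open>g a = 0\<close>])
    show "c > 0" using that by simp
    have "c * (b - a) \<le> c * (d / 2)" using assms(2) \<open>c > 0\<close> by (intro mult_left_mono) auto
    also have "\<dots> < pi / d * (d / 2)" using that \<open>d > 0\<close> by (intro mult_strict_right_mono) auto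
    finally show "c * (b - a) < pi / 2" using \<open>d > 0\<close> by simp
  qed
  have "(pi / d)^2 * ?A \<le> ?B"
  proof (rule tendsto_upperbound)
    show "((\<lambda>c. c^2 * ?A) \<longlongrightarrow> (pi / d)^2 * ?A) (at_left (pi / d))"
      by (intro tendsto_intros)
    show "\<forall>\<^sub>F c in at_left (pi / d). c^2 * ?A \<le> ?B"
      using eventually_mono[OF eventually_at_left_real[of 0 "pi / d"]] \<open>d > 0\<close> le by simp
  qed simp
  then have "(d / pi)^2 * ((pi / d)^2 * ?A) \<le> (d / pi)^2 * ?B"
    by (intro mult_left_mono) auto
  then show ?thesis using \<open>d > 0\<close> by (simp add: power_divide)
qed

text \<open>The function \<open>G t - G p\<close> vanishes at \<open>p\<close>, so the one-endpoint
  version applies on each side; the left part is reflected by t to -t.\<close>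

lemma wirtinger:
  fixes G G' :: "real \<Rightarrow> complex"
  assumes "a \<le> p" "p \<le> b" "2 * (p - a) \<le> d" "2 * (b - p) \<le> d" "d > 0"
    and G: "\<And>t. (G has_vector_derivative G' t) (at t)"
    and G': "continuous_on UNIV G'"
  shows "integral {a..b} (\<lambda>t. (cmod (G t - G p))^2) \<le> (d / pi)^2 * integral {a..b} (\<lambda>t. (cmod (G' t))^2)"
proof -
  have cG: "continuous_on S G" for S
    by (rule continuous_on_vector_derivative[OF has_vector_derivative_at_within[OF G]])
  have cG': "continuous_on S G'" for S using G' by (rule continuous_on_subset) simp
  have int: "(\<lambda>t. (cmod (G t - G p))^2) integrable_on {u..v}" "(\<lambda>t. (cmod (G' t))^2) integrable_on {u..v}" for u v
    by (intro integrable_continuous_real continuous_intros cG cG')+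
  have right: "integral {p..b} (\<lambda>t. (cmod (G t - G p))^2) \<le> (d / pi)^2 * integral {p..b} (\<lambda>t. (cmod (G' t))^2)"
  proof (rule wirtinger_left[OF assms(2,4,5)])
    have "((\<lambda>t. G t - G p) has_vector_derivative G' t - 0) (at t)" for t
      by (intro has_vector_derivative_diff G has_vector_derivative_const)
    then show "((\<lambda>t. G t - G p) has_vector_derivative G' t) (at t within {p..b})" for t
      unfolding diff_zero by (rule has_vector_derivative_at_within)
  qed (use cG' in simp_all)
  have "integral {-p..-a} (\<lambda>t. (cmod (G (-t) - G p))^2)
      \<le> (d / pi)^2 * integral {-p..-a} (\<lambda>t. (cmod (- G' (-t)))^2)"
  proof (rule wirtinger_left)
    fix t assume "t \<in> {-p..-a}"
    have "(uminus has_vector_derivative (-1::real)) (at t)"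
      using has_vector_derivative_minus[OF has_vector_derivative_id] by simp
    from has_vector_derivative_diff[OF vector_diff_chain_at[OF this G] has_vector_derivative_const]
    have "((\<lambda>t. G (- t) - G p) has_vector_derivative - G' (- t)) (at t)"
      by (simp add: o_def)
    then show "((\<lambda>t. G (- t) - G p) has_vector_derivative - G' (- t)) (at t within {-p..-a})"
      by (rule has_vector_derivative_at_within)
  next
    show "continuous_on {-p..-a} (\<lambda>t. - G' (- t))"
      by (intro continuous_intros continuous_on_compose2[OF G']) simp
  qed (use assms in simp_all)
  then have left: "integral {a..p} (\<lambda>t. (cmod (G t - G p))^2) \<le> (d / pi)^2 * integral {a..p} (\<lambda>t. (cmod (G' t))^2)"
    using Henstock_Kurzweil_Integration.integral_reflect_real[of p a "\<lambda>t. (cmod (G t - G p))^2"]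
      Henstock_Kurzweil_Integration.integral_reflect_real[of p a "\<lambda>t. (cmod (G' t))^2"] by simp
  show ?thesis
    unfolding Henstock_Kurzweil_Integration.integral_combine[OF assms(1,2) int(1), symmetric]
      Henstock_Kurzweil_Integration.integral_combine[OF assms(1,2) int(2), symmetric] distrib_left
    using left right by (rule add_mono)
qed

subsection \<open>Comparing the samples with the continuous energy\<close>

text \<open>The right-hand side has infimum (sqrt Y + sqrt Z)^2 over t, formally at t = sqrt Z /
  sqrt Y. The weighted form is linear in the energies, so it can be integrated cell by cell and
  summed before the roots are taken.\<close>

lemma minkowski_from_weighted:
  assumes "Y \<ge> 0" "Z \<ge> 0" and le: "\<And>t. t > 0 \<Longrightarrow> X \<le> (1 + t) * Y + (1 + 1 / t) * Z"
  shows "sqrt X \<le> sqrt Y + sqrt Z"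
proof (rule field_le_epsilon)
  fix \<epsilon> :: real assume "\<epsilon> > 0"
  \<comment> \<open>Padding by \<epsilon>/2 keeps the optimal t defined and positive even if
    \<open>Y\<close> or \<open>Z\<close> is 0.\<close>
  let ?y = "sqrt Y + \<epsilon> / 2" and ?z = "sqrt Z + \<epsilon> / 2"
  have pos: "?y > 0" "?z > 0" using assms \<open>\<epsilon> > 0\<close> by (auto intro: add_nonneg_pos)
  have "Y \<le> ?y^2" "Z \<le> ?z^2"
    using assms \<open>\<epsilon> > 0\<close> power_mono[of "sqrt Y" ?y 2] power_mono[of "sqrt Z" ?z 2] by simp_all
  then have "(1 + ?z / ?y) * Y + (1 + 1 / (?z / ?y)) * Z \<le> (1 + ?z / ?y) * ?y^2 + (1 + 1 / (?z / ?y)) * ?z^2"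
    using pos by (intro add_mono mult_left_mono) auto
  also have "\<dots> = (?y + ?z)^2"
  proof -
    have "(1 + z / y) * y^2 + (1 + 1 / (z / y)) * z^2 = (y + z)^2" if "y > 0" "z > 0" for y z :: real
      using that by (simp add: power2_eq_square field_simps)
    then show ?thesis using pos by blast
  qed
  finally have "X \<le> (?y + ?z)^2" using le[of "?z / ?y"] pos by simp
  then have "sqrt X \<le> ?y + ?z" using pos by (intro real_le_lsqrt) auto
  then show "sqrt X \<le> sqrt Y + sqrt Z + \<epsilon>" by simp
qed

lemma norm_square_le_weighted:
  fixes u v :: "'a :: real_normed_vector"
  assumes "t > 0"
  shows "(norm u)^2 \<le> (1 + t) * (norm v)^2 + (1 + 1 / t) * (norm (u - v))^2"
proof -
  let ?v = "norm v" and ?d = "norm (u - v)"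
  have "norm u \<le> ?v + ?d" by (metis add.commute norm_triangle_sub)
  then have "(norm u)^2 \<le> (?v + ?d)^2" by (intro power_mono) auto
  also have "\<dots> \<le> (1 + t) * ?v^2 + (1 + 1 / t) * ?d^2"
  proof -
    have "0 \<le> (t * ?v - ?d)^2 / t" using assms by simp
    also have "(t * ?v - ?d)^2 / t = t * ?v^2 - 2 * ?v * ?d + ?d^2 / t"
      using assms by (simp add: power2_eq_square field_simps)
    finally show ?thesis by (simp add: power2_sum algebra_simps)
  qed
  finally show ?thesis .
qed

text \<open>The order of the end points is proved alongside because the induction step needs it to
  join the intervals.\<close>

lemma integral_sum_pieces:
  fixes F :: "real \<Rightarrow> real"
  assumes F: "continuous_on UNIV F" and a: "\<And>n. n < N \<Longrightarrow> a n \<le> a (Suc n)"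
  shows "a 0 \<le> a N \<and> (\<Sum>n<N. integral {a n..a (Suc n)} F) = integral {a 0..a N} F"
  using a
proof (induction N)
  case (Suc N)
  have "F integrable_on {a 0..a (Suc N)}"
    using F by (intro integrable_continuous_real continuous_on_subset[OF F]) auto
  moreover have "a N \<le> a (Suc N)" "a 0 \<le> a N" using Suc by auto
  ultimately have "integral {a 0..a N} F + integral {a N..a (Suc N)} F = integral {a 0..a (Suc N)} F"
    by (intro Henstock_Kurzweil_Integration.integral_combine)
  then show ?case using Suc order.trans[OF \<open>a 0 \<le> a N\<close> \<open>a N \<le> a (Suc N)\<close>] by auto
qed simp

text \<open>Cell boundaries: the cell of the sample \<open>w (Suc n)\<close> runs from index
  \<open>n\<close> to \<open>Suc n\<close>, and its length is the weight of that sample.\<close>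

definition midpoint_ext :: "real \<Rightarrow> nat \<Rightarrow> (nat \<Rightarrow> real) \<Rightarrow> nat \<Rightarrow> real" where
  "midpoint_ext K N w n = (wext K N w n + wext K N w (n + 1)) / 2"

lemma KD_dense_gap:
  assumes KD: "KD_dense K \<delta> N w" and "n \<le> N"
  shows "wext K N w n \<le> wext K N w (n + 1)" "wext K N w (n + 1) - wext K N w n \<le> \<delta>"
proof -
  show "wext K N w (n + 1) - wext K N w n \<le> \<delta>"
    using assms by (auto simp: KD_dense_def)
  have N: "N \<ge> 1" and mono: "strict_mono_on {1..N} w" and ran: "w ` {1..N} \<subseteq> {-K..K}"
    using KD by (auto simp: KD_dense_def)
  \<comment> \<open>This settles the two wrap-around gaps: w N - 2K \<le> -K \<le> w 1 and w N \<le>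
    K \<le> w 1 + 2K.\<close>
  have "w 1 \<in> {-K..K}" "w N \<in> {-K..K}" using ran N by (auto simp: image_subset_iff)
  moreover have "w n \<le> w (n + 1)" if "1 \<le> n" "n < N"
    using strict_mono_onD[OF mono, of n "n + 1"] that by auto
  ultimately show "wext K N w n \<le> wext K N w (n + 1)"
    using \<open>n \<le> N\<close> N by (cases "n = 0"; cases "n = N") (auto simp: wext_def)
qed

lemma weight_eq_midpoint:
  "weight K N w (Suc n) = midpoint_ext K N w (Suc n) - midpoint_ext K N w n"
  by (simp add: weight_def midpoint_ext_def field_simps)

text \<open>Each sample splits its cell into two parts of length at most \<delta>/2, in the form
  that \<open>wirtinger\<close> asks for.\<close>

lemma midpoint_ext_mono:
  assumes "KD_dense K \<delta> N w" "n < N"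
  shows "midpoint_ext K N w n \<le> wext K N w (Suc n)" "wext K N w (Suc n) \<le> midpoint_ext K N w (Suc n)"
    "2 * (wext K N w (Suc n) - midpoint_ext K N w n) \<le> \<delta>"
    "2 * (midpoint_ext K N w (Suc n) - wext K N w (Suc n)) \<le> \<delta>"
  using KD_dense_gap[OF assms(1), of n] KD_dense_gap[OF assms(1), of "Suc n"] assms(2)
  by (simp_all add: midpoint_ext_def field_simps)

lemma weight_nonneg:
  assumes "KD_dense K \<delta> N w" "n \<in> {1..N}"
  shows "weight K N w n \<ge> 0"
proof -
  have "n - 1 < N" "Suc (n - 1) = n" using assms(2) by auto
  then show ?thesis
    using midpoint_ext_mono(1,2)[OF assms(1), of "n - 1"] weight_eq_midpoint[of K N w "n - 1"] by simp
qed

text \<open>The cells fill [m - K, m + K] with m = (w 1 + w N)/2. The distances of w 1 from -K and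
  of w N from K are nonnegative with sum at most \<delta>, so |m| \<le> \<delta>/2 < 1/2. This is
  where the 1/2 in K - 1/2 comes from.\<close>

lemma midpoint_ext_cover:
  assumes KD: "KD_dense K \<delta> N w"
  shows "{- (K - 1/2)<..<K - 1/2} \<subseteq> {midpoint_ext K N w 0..midpoint_ext K N w N}"
proof -
  have N: "N \<ge> 1" and ran: "w ` {1..N} \<subseteq> {-K..K}" and "\<delta> < 1"
    using KD by (auto simp: KD_dense_def)
  have "w 1 \<in> {-K..K}" "w N \<in> {-K..K}" using ran N by (auto simp: image_subset_iff)
  moreover have "w 1 + 2 * K - w N \<le> \<delta>"
    using KD_dense_gap(2)[OF KD, of N] N by (simp add: wext_def)
  ultimately show ?thesis using N \<open>\<delta> < 1\<close> by (auto simp: midpoint_ext_def wext_def)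
qed

text \<open>The quadratic form of the sampling operator, and also the integral over the cells of
  |fhat|^2 frozen at the sample of each cell.\<close>

definition sample_energy :: "real \<Rightarrow> nat \<Rightarrow> (nat \<Rightarrow> real) \<Rightarrow> fn \<Rightarrow> real" where
  "sample_energy K N w f = (\<Sum>n=1..N. weight K N w n * (cmod (fourier f (w n)))^2)"

lemma sample_energy_nonneg:
  "KD_dense K \<delta> N w \<Longrightarrow> sample_energy K N w f \<ge> 0"
  unfolding sample_energy_def by (intro sum_nonneg mult_nonneg_nonneg weight_nonneg) auto

lemma integral_fourier_le:
  assumes "f \<in> HH"
  shows "integral {a..b} (\<lambda>t. (cmod (fourier f t))^2) \<le> (norm_L2 f)^2"
proof -
  have F: "continuous_on S (\<lambda>t. (cmod (fourier f t))^2)" for S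
    by (intro continuous_intros continuous_on_fourier assms)
  have "integral {a..b} (\<lambda>t. (cmod (fourier f t))^2) = (LINT t:{a..b}|lborel. (cmod (fourier f t))^2)"
    by (rule set_borel_integral_eq_integral(2)[OF borel_integrable_atLeastAtMost'[OF F], symmetric])
  also have "\<dots> \<le> (LINT t|lborel. (cmod (fourier f t))^2)"
    unfolding set_lebesgue_integral_def
    using borel_integrable_atLeastAtMost'[OF F, of a b] plancherel(1)[OF assms]
    by (intro integral_mono) (auto simp: set_integrable_def indicator_def)
  finally show ?thesis using plancherel(2)[OF assms] by simp
qed

text \<open>The modulation by \<open>cis (pi t)\<close> centres the support of \<open>f\<close> at \<open>0\<close>, which halves the
  bound on the derivative.\<close>

lemma sample_energy_comparison:
  assumes KD: "KD_dense K \<delta> N w" and f: "f \<in> HH"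
  defines "A \<equiv> integral {midpoint_ext K N w 0..midpoint_ext K N w N} (\<lambda>t. (cmod (fourier f t))^2)"
  shows "sqrt A \<le> sqrt (sample_energy K N w f) + \<delta> * norm_L2 f"
    and "sqrt (sample_energy K N w f) \<le> sqrt A + \<delta> * norm_L2 f"
proof -
  have "\<delta> > 0" using KD by (simp add: KD_dense_def)
  let ?h = "\<lambda>x. (-2 * pi * \<i> * (of_real x - 1/2)) * f x"
  let ?d = "\<lambda>x. (-2 * pi * \<i> * of_real x) * f x"
  define G where "G t = fourier f t * cis (pi * t)" for t
  define G' where "G' t = fourier ?h t * cis (pi * t)" for t
  let ?a = "midpoint_ext K N w" and ?p = "\<lambda>n. w (Suc n)"
  have hbound: "cmod (-2 * pi * \<i> * (of_real x - 1/2)) \<le> pi" if "x \<in> {0..1}" for x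
  proof -
    have "complex_of_real x - 1/2 = of_real (x - 1/2)" by simp
    then have "cmod (-2 * pi * \<i> * (of_real x - 1/2)) = 2 * pi * \<bar>x - 1/2\<bar>"
      by (simp only: norm_mult norm_of_real) simp
    also have "\<bar>x - 1/2\<bar> \<le> 1/2" using that unfolding abs_le_iff atLeastAtMost_iff by linarith
    finally show ?thesis by simp
  qed
  have hH: "?h \<in> HH" by (rule HH_mult[OF f _ hbound]) auto
  have nh: "norm_L2 ?h \<le> pi * norm_L2 f" by (rule norm_L2_mult_le[OF f _ _ hbound]) auto
  have dH: "?d \<in> HH" by (rule HH_mult[OF f, where B = "2 * pi"]) (auto simp: norm_mult)
  \<comment> \<open>The product rule for the modulation adds i pi fhat, which turns the factor x of
    the derivative into x - 1/2.\<close>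
  have "?h = (\<lambda>x. ?d x + (\<i> * pi) * f x)" by (auto simp: algebra_simps)
  then have fh: "fourier ?h t = fourier ?d t + \<i> * pi * fourier f t" for t
    by (simp only: fourier_add[OF dH HH_cmult[OF f]] fourier_cmult)
  have G: "(G has_vector_derivative G' t) (at t)" for t
  proof -
    have "((\<lambda>z. exp (\<i> * (pi * z))) has_field_derivative exp (\<i> * (pi * of_real t)) * (\<i> * pi)) (at (of_real t))"
      by (auto intro!: derivative_eq_intros)
    from has_vector_derivative_real_field[OF this]
    have "((\<lambda>t. cis (pi * t)) has_vector_derivative cis (pi * t) * (\<i> * pi)) (at t)"
      by (simp add: cis_conv_exp)
    from has_vector_derivative_mult[OF fourier_has_vector_derivative[OF f] this]
    show ?thesis unfolding G_def[abs_def] G'_def fh by (simp add: algebra_simps)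
  qed
  have contG: "continuous_on S G" for S
    by (rule continuous_on_vector_derivative[OF has_vector_derivative_at_within[OF G]])
  have contG': "continuous_on S G'" for S
    unfolding G'_def[abs_def] by (intro continuous_intros continuous_on_fourier hH)
  have nG: "cmod (G t) = cmod (fourier f t)" "cmod (G' t) = cmod (fourier ?h t)" for t
    by (simp_all add: G_def G'_def norm_mult)
  have p: "wext K N w (Suc n) = ?p n" if "n < N" for n using that by (simp add: wext_def)
  have a: "?a n \<le> ?a (Suc n)" if "n < N" for n using midpoint_ext_mono[OF KD that] by linarith
  let ?A = "\<lambda>n. integral {?a n..?a (Suc n)} (\<lambda>t. (cmod (G t))^2)"
  let ?D = "\<lambda>n. integral {?a n..?a (Suc n)} (\<lambda>t. (cmod (G t - G (?p n)))^2)"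
  let ?B = "\<lambda>n. integral {?a n..?a (Suc n)} (\<lambda>t. (cmod (G' t))^2)"
  let ?Q = "\<lambda>n. (?a (Suc n) - ?a n) * (cmod (G (?p n)))^2"
  let ?Z = "(\<delta> * norm_L2 f)^2"
  have contA: "continuous_on UNIV (\<lambda>t. (cmod (G t))^2)"
    and contB: "continuous_on UNIV (\<lambda>t. (cmod (G' t))^2)"
    by (intro continuous_intros contG contG')+
  have A: "(\<Sum>n<N. ?A n) = A"
    unfolding A_def
    using conjunct2[OF integral_sum_pieces[where a = ?a, OF contA a]] unfolding nG .
  have B: "(\<Sum>n<N. ?B n) = integral {?a 0..?a N} (\<lambda>t. (cmod (fourier ?h t))^2)"
    using conjunct2[OF integral_sum_pieces[where a = ?a, OF contB a]] unfolding nG .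
  \<comment> \<open>Cells are counted from 0, samples from 1.\<close>
  have Q: "(\<Sum>n<N. ?Q n) = sample_energy K N w f"
    unfolding sample_energy_def
    by (rule sum.reindex_bij_witness[of _ "\<lambda>n. n - 1" Suc]) (auto simp: weight_eq_midpoint nG)
  have "(\<Sum>n<N. ?D n) \<le> (\<Sum>n<N. (\<delta> / pi)^2 * ?B n)"
  proof (rule sum_mono)
    fix n assume "n \<in> {..<N}"
    then have n: "n < N" by simp
    show "?D n \<le> (\<delta> / pi)^2 * ?B n"
      using midpoint_ext_mono[OF KD n] unfolding p[OF n]
      by (intro wirtinger G contG' \<open>\<delta> > 0\<close>)
  qed
  also have "\<dots> = (\<delta> / pi)^2 * integral {?a 0..?a N} (\<lambda>t. (cmod (fourier ?h t))^2)"
    by (simp only: B flip: sum_distrib_left)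
  \<comment> \<open>Plancherel for \<open>?h\<close>, whose multiplier is at most pi on the support;
    this pi cancels the Wirtinger constant.\<close>
  also have "\<dots> \<le> (\<delta> / pi)^2 * (pi * norm_L2 f)^2"
    by (intro mult_left_mono order.trans[OF integral_fourier_le[OF hH]] power_mono nh norm_L2_nonneg) auto
  also have "\<dots> = ?Z" by (simp add: power_mult_distrib power_divide)
  finally have D: "(\<Sum>n<N. ?D n) \<le> ?Z" .
  have int: "(\<lambda>t. (cmod (G t))^2) integrable_on {u..v}" "(\<lambda>t. (cmod (G t - z))^2) integrable_on {u..v}"
    "(\<lambda>t. c) integrable_on {u..v}" for u v z and c :: real
    by (intro integrable_continuous_real continuous_intros contG)+
  have lin: "integral {u..v} (\<lambda>x. c * X x + d * Y x) = c * integral {u..v} X + d * integral {u..v} Y"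
    if "X integrable_on {u..v}" "Y integrable_on {u..v}" for u v c d :: real and X Y :: "real \<Rightarrow> real"
    using Henstock_Kurzweil_Integration.integral_add[OF integrable_on_cmult_left[OF that(1), of c]
        integrable_on_cmult_left[OF that(2), of d]] by simp
  \<comment> \<open>On each cell the weighted inequality is integrated in both directions, with the
    function and its frozen value exchanging roles.\<close>
  have pw: "?A n \<le> (1 + t) * ?Q n + (1 + 1 / t) * ?D n" "?Q n \<le> (1 + t) * ?A n + (1 + 1 / t) * ?D n"
    if "t > 0" "n < N" for t n
  proof -
    let ?S = "{?a n..?a (Suc n)}"
    have c: "integral ?S (\<lambda>x. (cmod (G (?p n)))^2) = ?Q n" using a[OF that(2)] by simp
    have "?A n \<le> integral ?S (\<lambda>x. (1 + t) * (cmod (G (?p n)))^2 + (1 + 1 / t) * (cmod (G x - G (?p n)))^2)"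
      by (rule Henstock_Kurzweil_Integration.integral_le[OF int(1) _ norm_square_le_weighted[OF that(1)]])
        (intro integrable_continuous_real continuous_intros contG)
    then show "?A n \<le> (1 + t) * ?Q n + (1 + 1 / t) * ?D n"
      by (simp only: lin[OF int(3,2)] c)
    have "integral ?S (\<lambda>x. (cmod (G (?p n)))^2)
        \<le> integral ?S (\<lambda>x. (1 + t) * (cmod (G x))^2 + (1 + 1 / t) * (cmod (G x - G (?p n)))^2)"
    proof (rule Henstock_Kurzweil_Integration.integral_le[OF int(3)])
      show "(\<lambda>x. (1 + t) * (cmod (G x))^2 + (1 + 1 / t) * (cmod (G x - G (?p n)))^2) integrable_on ?S"
        by (intro integrable_continuous_real continuous_intros contG)
      show "(cmod (G (?p n)))^2 \<le> (1 + t) * (cmod (G x))^2 + (1 + 1 / t) * (cmod (G x - G (?p n)))^2" for x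
        using norm_square_le_weighted[OF that(1), of "G (?p n)" "G x"] by (simp only: norm_minus_commute)
    qed
    then show "?Q n \<le> (1 + t) * ?A n + (1 + 1 / t) * ?D n"
      by (simp only: lin[OF int(1,2)] c)
  qed
  have sums: "(\<Sum>n<N. (1 + t) * x n + (1 + 1 / t) * ?D n) \<le> (1 + t) * (\<Sum>n<N. x n) + (1 + 1 / t) * ?Z"
    if "t > 0" for t and x :: "nat \<Rightarrow> real"
    unfolding sum.distrib sum_distrib_left[symmetric]
    using D that by (intro add_left_mono mult_left_mono) auto
  have AQ: "A \<le> (1 + t) * sample_energy K N w f + (1 + 1 / t) * ?Z"
    "sample_energy K N w f \<le> (1 + t) * A + (1 + 1 / t) * ?Z" if "t > 0" for t
    using order.trans[OF sum_mono[of "{..<N}" ?A, OF pw(1)[OF that]] sums[OF that]]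
      order.trans[OF sum_mono[of "{..<N}" ?Q, OF pw(2)[OF that]] sums[OF that]]
    unfolding A Q by auto
  have "A \<ge> 0" unfolding A_def
    by (intro Henstock_Kurzweil_Integration.integral_nonneg integrable_continuous_real
        continuous_intros continuous_on_fourier f) auto
  moreover have "sqrt ?Z = \<delta> * norm_L2 f" using \<open>\<delta> > 0\<close> norm_L2_nonneg[of f] by simp
  ultimately show "sqrt A \<le> sqrt (sample_energy K N w f) + \<delta> * norm_L2 f"
    "sqrt (sample_energy K N w f) \<le> sqrt A + \<delta> * norm_L2 f"
    using minkowski_from_weighted[OF sample_energy_nonneg[OF KD] _ AQ(1)]
      minkowski_from_weighted[OF _ _ AQ(2)] by auto
qed

subsection \<open>Admissibility and the reconstruction constant\<close>

lemma norm_on_square: "(norm_on J g)^2 = (LINT x|lborel. indicator J x * (cmod (g x))^2)"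
  unfolding norm_on_def set_lebesgue_integral_def by simp

lemma integrable_indicator_fourier:
  assumes "f \<in> HH" "J \<in> sets borel"
  shows "integrable lborel (\<lambda>x. indicator J x * (cmod (fourier f x))^2)"
  using integrable_mult_indicator[OF _ plancherel(1)[OF assms(1)], of J] assms(2) by simp

lemma norm_on_nonneg: "norm_on J g \<ge> 0"
  unfolding norm_on_def set_lebesgue_integral_def by simp

lemma norm_on_fourier_le:
  assumes "f \<in> HH" "J \<in> sets borel"
  shows "norm_on J (fourier f) \<le> norm_L2 f"
proof (rule power2_le_imp_le)
  have "(norm_on J (fourier f))^2 \<le> (LINT x|lborel. (cmod (fourier f x))^2)"
    unfolding norm_on_square
    by (intro integral_mono integrable_indicator_fourier plancherel(1) assms) (auto simp: indicator_def)
  then show "(norm_on J (fourier f))^2 \<le> (norm_L2 f)^2" by (simp add: plancherel(2) assms)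
qed (rule norm_L2_nonneg)

lemma norm_on_fourier_cmult: "norm_on J (fourier (\<lambda>x. c * f x)) = cmod c * norm_on J (fourier f)"
proof -
  have "(norm_on J (fourier (\<lambda>x. c * f x)))^2
      = (LINT x|lborel. (cmod c)^2 * (indicator J x * (cmod (fourier f x))^2))"
    unfolding norm_on_square
    by (intro Bochner_Integration.integral_cong)
      (simp_all add: fourier_cmult norm_mult power_mult_distrib mult_ac)
  also have "\<dots> = (cmod c * norm_on J (fourier f))^2"
    by (simp add: norm_on_square power_mult_distrib)
  finally show ?thesis by (simp add: norm_on_nonneg power2_eq_iff_nonneg)
qed

text \<open>Homogeneity reduces the claim to unit vectors. The supremum is a real one, so
  boundedness has to be shown first; Plancherel gives the bound 1. Vectors of norm 0 have a
  transform of norm 0.\<close>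

lemma norm_on_le_resid:
  assumes T: "fin_dim_subspace T" and f: "f \<in> T"
  shows "norm_on (UNIV - {-z<..<z}) (fourier f) \<le> resid T z * norm_L2 f"
proof -
  let ?J = "UNIV - {-z<..<z}"
  let ?R = "insert 0 {norm_on ?J (fourier f) | f. f \<in> T \<and> norm_L2 f = 1}"
  have TH: "g \<in> HH" if "g \<in> T" for g using T that by (auto simp: fin_dim_subspace_def)
  have J: "?J \<in> sets borel" by simp
  have bdd: "bdd_above ?R"
    by (auto intro!: bdd_aboveI[of _ 1]) (metis TH J norm_on_fourier_le)
  show ?thesis
  proof (cases "norm_L2 f = 0")
    case True
    then show ?thesis using norm_on_fourier_le[OF TH[OF f] J] by simp
  next
    case False
    then have n: "norm_L2 f > 0" using norm_L2_nonneg[of f] by simp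
    let ?c = "complex_of_real (1 / norm_L2 f)"
    have scale: "\<forall>f\<in>T. \<forall>c. (\<lambda>x. c * f x) \<in> T" using T unfolding fin_dim_subspace_def by (elim conjE)
    have "(\<lambda>x. ?c * f x) \<in> T" using spec[OF bspec[OF scale f], of ?c] .
    moreover have "norm_L2 (\<lambda>x. ?c * f x) = 1"
      unfolding norm_L2_cmult norm_of_real using n by simp
    ultimately have "norm_on ?J (fourier (\<lambda>x. ?c * f x)) \<le> resid T z"
      unfolding resid_def by (intro cSup_upper bdd) blast
    then show ?thesis
      unfolding norm_on_fourier_cmult norm_of_real using n by (simp add: field_simps)
  qed
qed

text \<open>The interval and the complement of (-z, z) together cover the line, so their energies
  add up to at least the norm squared, and \<open>resid\<close> controls the second one.\<close>

lemma fourier_energy_lower_bound: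
  assumes T: "fin_dim_subspace T" and f: "f \<in> T" and cover: "{-z<..<z} \<subseteq> {a..b}"
  shows "(1 - (resid T z)^2) * (norm_L2 f)^2 \<le> integral {a..b} (\<lambda>t. (cmod (fourier f t))^2)"
proof -
  let ?F = "\<lambda>t. (cmod (fourier f t))^2" and ?J = "UNIV - {-z<..<z}"
  have fH: "f \<in> HH" using T f by (auto simp: fin_dim_subspace_def)
  have F: "continuous_on S ?F" for S by (intro continuous_intros continuous_on_fourier fH)
  have "(norm_L2 f)^2 = (LINT t|lborel. ?F t)" by (simp add: plancherel(2) fH)
  also have "\<dots> \<le> (LINT t|lborel. indicator {a..b} t * ?F t + indicator ?J t * ?F t)"
    using cover by (intro integral_mono Bochner_Integration.integrable_add integrable_indicator_fourier
        plancherel(1) fH) (auto simp: indicator_def)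
  also have "\<dots> = (LINT t|lborel. indicator {a..b} t * ?F t) + (norm_on ?J (fourier f))^2"
    unfolding norm_on_square
    by (intro Bochner_Integration.integral_add integrable_indicator_fourier fH) auto
  also have "(LINT t|lborel. indicator {a..b} t * ?F t) = integral {a..b} ?F"
    using set_borel_integral_eq_integral(2)[OF borel_integrable_atLeastAtMost'[OF F, of a b]]
    by (simp add: set_lebesgue_integral_def)
  also have "(norm_on ?J (fourier f))^2 \<le> (resid T z * norm_L2 f)^2"
    by (intro power_mono norm_on_le_resid T f norm_on_nonneg)
  finally show ?thesis by (simp add: algebra_simps power_mult_distrib)
qed

lemma sample_energy_upper_bound:
  assumes KD: "KD_dense K \<delta> N w" and f: "f \<in> HH"
  shows "sample_energy K N w f \<le> (1 + \<delta>)^2 * (norm_L2 f)^2"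
proof -
  have "\<delta> > 0" using KD by (simp add: KD_dense_def)
  let ?A = "integral {midpoint_ext K N w 0..midpoint_ext K N w N} (\<lambda>t. (cmod (fourier f t))^2)"
  have "sqrt ?A \<le> norm_L2 f"
    using integral_fourier_le[OF f] norm_L2_nonneg[of f] by (intro real_le_lsqrt)
  then have "sqrt (sample_energy K N w f) \<le> (1 + \<delta>) * norm_L2 f"
    using sample_energy_comparison(2)[OF KD f] by (simp add: algebra_simps)
  then have "(sqrt (sample_energy K N w f))^2 \<le> ((1 + \<delta>) * norm_L2 f)^2"
    by (intro power_mono) (simp_all add: sample_energy_nonneg[OF KD])
  then show ?thesis by (simp add: sample_energy_nonneg[OF KD] power_mult_distrib)
qed

lemma sample_energy_lower_bound:
  assumes T: "fin_dim_subspace T" and KD: "KD_dense K \<delta> N w"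
    and \<delta>: "\<delta> < sqrt (1 - (resid T (K - 1/2))^2)" and f: "f \<in> T"
  shows "(sqrt (1 - (resid T (K - 1/2))^2) - \<delta>)^2 * (norm_L2 f)^2 \<le> sample_energy K N w f"
proof -
  let ?s = "sqrt (1 - (resid T (K - 1/2))^2)"
  have fH: "f \<in> HH" using T f by (auto simp: fin_dim_subspace_def)
  have "?s * norm_L2 f = sqrt ((1 - (resid T (K - 1/2))^2) * (norm_L2 f)^2)"
    using norm_L2_nonneg[of f] by (simp add: real_sqrt_mult)
  also have "\<dots> \<le> sqrt (integral {midpoint_ext K N w 0..midpoint_ext K N w N} (\<lambda>t. (cmod (fourier f t))^2))"
    by (intro real_sqrt_le_mono fourier_energy_lower_bound[OF T f midpoint_ext_cover[OF KD]])
  also have "\<dots> \<le> sqrt (sample_energy K N w f) + \<delta> * norm_L2 f"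
    by (rule sample_energy_comparison(1)[OF KD fH])
  finally have "(?s - \<delta>) * norm_L2 f \<le> sqrt (sample_energy K N w f)" by (simp add: algebra_simps)
  \<comment> \<open>The hypothesis on \<delta> makes the left-hand side nonnegative, so squaring
    preserves the inequality.\<close>
  then have "((?s - \<delta>) * norm_L2 f)^2 \<le> (sqrt (sample_energy K N w f))^2"
    using \<delta> norm_L2_nonneg[of f] by (intro power_mono) auto
  then show ?thesis by (simp add: sample_energy_nonneg[OF KD] power_mult_distrib)
qed

section \<open>The sampling operator and its quadratic form\<close>

lemma norm_L2_indicator: "norm_L2 (indicator {0..1}) = 1"
proof -
  have "(\<lambda>x. (cmod (indicator {0..1} x))\<^sup>2) = (indicator {0..1} :: real \<Rightarrow> real)"
    by (auto simp: indicator_def)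
  then show ?thesis by (simp add: norm_L2_def)
qed

text \<open>The cutoff disappears because \<open>g\<close> vanishes off [0,1]. What remains is a
  diagonal Hermitian form in the samples; self-adjointness, the Cauchy-Schwarz condition and the
  energy are all read off from it.\<close>

lemma samp_op_inner:
  assumes g: "g \<in> HH"
  shows "inner_L2 (samp_op K N w f) g
    = (\<Sum>n=1..N. complex_of_real (weight K N w n) * fourier f (w n) * cnj (fourier g (w n)))"
proof -
  have eq: "samp_op K N w f x * cnj (g x)
      = (\<Sum>n=1..N. (complex_of_real (weight K N w n) * fourier f (w n))
          * cnj (g x * cis (-2 * pi * w n * x)))" for x
    using HH_outside[OF g, of x]
    by (cases "x \<in> {0..1}")
      (simp_all add: samp_op_def sum_distrib_left sum_distrib_right cis_cnj mult_ac)
  have int: "integrable lborel (\<lambda>x. cnj (g x * cis (-2 * pi * w n * x)))" for n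
    using integrable_cnj[of lborel "\<lambda>x. g x * cis (-2 * pi * w n * x)"] fourier_integrable[OF g] by blast
  show ?thesis
    unfolding inner_L2_def eq fourier_def[of g] Bochner_Integration.integral_cnj[symmetric]
    by (subst Bochner_Integration.integral_sum)
      (simp_all only: integrable_mult_right int integral_mult_right_zero)
qed

lemma samp_op_inner_self:
  "f \<in> HH \<Longrightarrow> inner_L2 (samp_op K N w f) f = complex_of_real (sample_energy K N w f)"
  unfolding samp_op_inner sample_energy_def of_real_sum of_real_mult complex_norm_square
  by (simp add: mult.assoc)

lemma HH_samp_op: "samp_op K N w f \<in> HH"
  and norm_samp_op_le: "f \<in> HH \<Longrightarrow> norm_L2 (samp_op K N w f) \<le> (\<Sum>n=1..N. \<bar>weight K N w n\<bar>) * norm_L2 f"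
proof -
  let ?u = "\<lambda>x. \<Sum>n=1..N. complex_of_real (weight K N w n) * fourier f (w n) * cis (2 * pi * w n * x)"
  have S: "samp_op K N w f = (\<lambda>x. ?u x * indicator {0..1} x)" by (auto simp: samp_op_def)
  have u: "?u \<in> borel_measurable borel" by measurable
  have le: "cmod (?u x) \<le> (\<Sum>n=1..N. \<bar>weight K N w n\<bar> * cmod (fourier f (w n)))" for x
    by (rule order.trans[OF norm_sum]) (simp add: norm_mult)
  show "samp_op K N w f \<in> HH" unfolding S by (rule HH_mult[OF HH_indicator u le])
  assume f: "f \<in> HH"
  have "(\<Sum>n=1..N. \<bar>weight K N w n\<bar> * cmod (fourier f (w n))) \<le> (\<Sum>n=1..N. \<bar>weight K N w n\<bar>) * norm_L2 f"
    unfolding sum_distrib_right by (intro sum_mono mult_left_mono norm_fourier_le f) auto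
  then have "norm_L2 (samp_op K N w f)
      \<le> (\<Sum>n=1..N. \<bar>weight K N w n\<bar>) * norm_L2 f * norm_L2 (indicator {0..1})"
    unfolding S using norm_L2_nonneg[of f]
    by (intro norm_L2_mult_le[OF HH_indicator u] order.trans[OF le] mult_nonneg_nonneg sum_nonneg) auto
  then show "norm_L2 (samp_op K N w f) \<le> (\<Sum>n=1..N. \<bar>weight K N w n\<bar>) * norm_L2 f"
    by (simp add: norm_L2_indicator)
qed

lemma bounded_linear_op_samp_op: "bounded_linear_op (samp_op K N w)"
  unfolding bounded_linear_op_def
proof (intro conjI ballI allI exI)
  fix f g assume fg: "f \<in> HH" "g \<in> HH"
  show "samp_op K N w (\<lambda>x. f x + g x) = (\<lambda>x. samp_op K N w f x + samp_op K N w g x)"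
    by (rule ext) (simp add: samp_op_def fourier_add[OF fg] algebra_simps sum.distrib)
next
  fix f and c :: complex
  show "samp_op K N w (\<lambda>x. c * f x) = (\<lambda>x. c * samp_op K N w f x)"
    by (rule ext) (simp add: samp_op_def fourier_cmult sum_distrib_left mult_ac)
qed (auto intro: HH_samp_op norm_samp_op_le)

text \<open>Nonnegative weights split into two square roots, and the finite Cauchy-Schwarz
  inequality applies to the weighted sample vectors.\<close>

lemma samp_op_cauchy_schwarz:
  assumes KD: "KD_dense K \<delta> N w" and f: "f \<in> HH" and g: "g \<in> HH"
  shows "cmod (inner_L2 (samp_op K N w f) g) \<le> sqrt (sample_energy K N w f * sample_energy K N w g)"
proof (rule real_le_rsqrt)
  let ?a = "\<lambda>f n. sqrt (weight K N w n) * cmod (fourier f (w n))"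
  have E: "(\<Sum>n=1..N. (?a f n)^2) = sample_energy K N w f" for f
    unfolding sample_energy_def
    by (intro sum.cong) (simp_all add: power_mult_distrib weight_nonneg[OF KD])
  have "cmod (inner_L2 (samp_op K N w f) g)
      \<le> (\<Sum>n=1..N. cmod (complex_of_real (weight K N w n) * fourier f (w n) * cnj (fourier g (w n))))"
    unfolding samp_op_inner[OF g] by (rule norm_sum)
  also have "\<dots> = (\<Sum>n=1..N. ?a f n * ?a g n)"
  proof (intro sum.cong refl)
    fix n assume "n \<in> {1..N}"
    then have "weight K N w n = sqrt (weight K N w n) * sqrt (weight K N w n)" "weight K N w n \<ge> 0"
      using weight_nonneg[OF KD] by simp_all
    then show "cmod (complex_of_real (weight K N w n) * fourier f (w n) * cnj (fourier g (w n)))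
        = ?a f n * ?a g n"
      by (simp add: norm_mult mult_ac)
  qed
  finally have "(cmod (inner_L2 (samp_op K N w f) g))^2 \<le> (\<Sum>n=1..N. ?a f n * ?a g n)^2"
    by (intro power_mono) auto
  also have "\<dots> \<le> sample_energy K N w f * sample_energy K N w g"
    using Cauchy_Schwarz_ineq_sum[of "?a f" "?a g" "{1..N}"] unfolding E .
  finally show "(cmod (inner_L2 (samp_op K N w f) g))^2 \<le> sample_energy K N w f * sample_energy K N w g" .
qed

text \<open>The constants are extended reals. The work is to show that the upper one is finite and
  nonnegative and to handle an infinite lower one.\<close>

lemma recon_const_le:
  assumes "L > 0" "U \<ge> 0"
    and lower: "\<And>f. f \<in> T \<Longrightarrow> L^2 * (norm_L2 f)^2 \<le> Re (inner_L2 (S f) f)"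
    and upper: "\<And>f. f \<in> HH \<Longrightarrow> Re (inner_L2 (S f) f) \<le> U^2 * (norm_L2 f)^2"
    and pos: "Re (inner_L2 (S (indicator {0..1})) (indicator {0..1})) \<ge> 0"
  shows "recon_const S T \<le> U / L"
proof -
  have uU: "upper_const S \<le> ereal (U^2)"
    unfolding upper_const_def using upper by (intro Inf_lower) auto
  have "upper_const S \<ge> 0"
    unfolding upper_const_def
  proof (rule Inf_greatest)
    fix x assume "x \<in> {ereal c | c. \<forall>f\<in>HH. Re (inner_L2 (S f) f) \<le> c * (norm_L2 f)^2}"
    then obtain c where "x = ereal c" "\<forall>f\<in>HH. Re (inner_L2 (S f) f) \<le> c * (norm_L2 f)^2" by blast
    \<comment> \<open>The indicator of [0,1] is a unit vector, so any admissible \<open>c\<close> is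
      at least the value of the form there.\<close>
    then show "0 \<le> x" using pos HH_indicator norm_L2_indicator by force
  qed
  with uU obtain u where u: "upper_const S = ereal u" "0 \<le> u" "u \<le> U^2"
    by (cases "upper_const S") auto
  have lL: "ereal (L^2) \<le> lower_const S T"
    unfolding lower_const_def using lower by (intro Sup_upper) auto
  have "real_of_ereal (upper_const S / lower_const S T) \<le> (U / L)^2"
  proof (cases "lower_const S T")
    case (real l)
    then have l: "L^2 \<le> l" using lL by simp
    moreover have "L^2 > 0" using \<open>L > 0\<close> by simp
    ultimately have "u / l \<le> U^2 / L^2" using u by (intro frac_le) auto
    then show ?thesis using u real l \<open>L^2 > 0\<close> by (simp add: power_divide)
  \<comment> \<open>An infinite lower constant occurs when all elements of \<open>T\<close> have
    norm 0; the quotient is then 0. Minus infinity contradicts \<open>lL\<close>.\<close>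
  qed (use lL u in auto)
  then show ?thesis
    unfolding recon_const_def using assms(1,2) by (intro real_le_lsqrt) auto
qed

theorem theorem4p5:
  fixes T :: "(real \<Rightarrow> complex) set" and K \<delta> :: real and N :: nat and w :: "nat \<Rightarrow> real"
  assumes "fin_dim_subspace T"
    and "K > 0"
    and "KD_dense K \<delta> N w"
    and "\<delta> < sqrt (1 - (resid T (K - 1/2))^2)"
  shows "admissible (samp_op K N w) (w ` {1..N}) T
    \<and> recon_const (samp_op K N w) T
        \<le> (1 + \<delta>) / (sqrt (1 - (resid T (K - 1/2))^2) - \<delta>)"
proof
  let ?s = "sqrt (1 - (resid T (K - 1/2))^2)"
  note KD = assms(3)
  have TH: "f \<in> HH" if "f \<in> T" for f using assms(1) that by (auto simp: fin_dim_subspace_def)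
  have lower: "(?s - \<delta>)^2 * (norm_L2 f)^2 \<le> Re (inner_L2 (samp_op K N w f) f)" if "f \<in> T" for f
    using sample_energy_lower_bound[OF assms(1,3,4) that] samp_op_inner_self[OF TH[OF that]] by simp
  have upper: "Re (inner_L2 (samp_op K N w f) f) \<le> (1 + \<delta>)^2 * (norm_L2 f)^2" if "f \<in> HH" for f
    using sample_energy_upper_bound[OF KD that] samp_op_inner_self[OF that] by simp
  show "admissible (samp_op K N w) (w ` {1..N}) T"
    unfolding admissible_def
  proof (intro conjI ballI impI)
    show "bounded_linear_op (samp_op K N w)" by (rule bounded_linear_op_samp_op)
    show "\<exists>C1>0. \<forall>f\<in>T. C1 * (norm_L2 f)^2 \<le> Re (inner_L2 (samp_op K N w f) f)"
      using lower assms(4) by (intro exI[of _ "(?s - \<delta>)^2"]) auto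
    fix f g assume fg: "f \<in> HH" "g \<in> HH"
    show "inner_L2 (samp_op K N w f) g = inner_L2 f (samp_op K N w g)"
      \<comment> \<open>Swapping the arguments on the right turns both sides into the same sum, as
        the weights are real.\<close>
      unfolding inner_L2_commute[of f] samp_op_inner[OF fg(1)] samp_op_inner[OF fg(2)]
      by (simp add: mult_ac)
    show "cmod (inner_L2 (samp_op K N w f) g)
        \<le> sqrt (Re (inner_L2 (samp_op K N w f) f) * Re (inner_L2 (samp_op K N w g) g))"
      using samp_op_cauchy_schwarz[OF KD fg] by (simp add: samp_op_inner_self fg)
    assume "\<forall>v\<in>w ` {1..N}. fourier f v = fourier g v"
    then show "samp_op K N w f = samp_op K N w g" by (auto simp: samp_op_def)
  qed
  show "recon_const (samp_op K N w) T \<le> (1 + \<delta>) / (?s - \<delta>)"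
    using assms(4) KD
    by (intro recon_const_le lower upper)
      (auto simp: samp_op_inner_self[OF HH_indicator] sample_energy_nonneg[OF KD] KD_dense_def)
qed

end
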